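(* There is an algorithm which, for every $n$, every function $f:\{0,1\}^n\to\{0,1\}$ with $f^{-1}(1)\neq\emptyset$ and every distance parameter $\varepsilon\in(0,1)$, is given oracle access to $\mathrm{MQ}(f)$ and $\mathrm{SAMP}(f)$, the value $N=|f^{-1}(1)|$, and $\varepsilon$, makes $\tilde{O}((\log N)/\varepsilon)$ calls in total to $\mathrm{MQ}(f)$ and $\mathrm{SAMP}(f)$, and satisfies: if $f$ is unate it accepts with probability $1$; if $\mathrm{reldist}(f,\mathsf{Unate})>\varepsilon$ it rejects with probability at least $2/3$.
   Context: Relative-error testing model: for an unknown $f:\{0,1\}^n\to\{0,1\}$, the membership oracle $\mathrm{MQ}(f)$ returns $f(x)$ on query $x\in\{0,1\}^n$, and each call to the sampling oracle $\mathrm{SAMP}(f)$ returns an independent uniformly random element of $f^{-1}(1)$. A function $f$ is unate if for every coordinate $i\in[n]$, either $f(x^{i\leftarrow 0})\le f(x^{i\leftarrow 1})$ for all $x$, or $f(x^{i\leftarrow 0})\ge f(x^{i\leftarrow 1})$ for all $x$ (here $x^{i\leftarrow b}$ is $x$ with its $i$-th bit set to $b$); $\mathsf{Unate}$ denotes the class of unate functions. For $f,g$ with $f^{-1}(1)\ne\emptyset$, $\mathrm{reldist}(f,g)=|f^{-1}(1)\,\triangle\, g^{-1}(1)|/|f^{-1}(1)|$ and $\mathrm{reldist}(f,\mathsf{Unate})=\min_{g\in\mathsf{Unate}}\mathrm{reldist}(f,g)$. Logarithms are base 2; $\tilde{O}(\cdot)$ hides polylogarithmic factors in its argument. *)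

theory Defs
  imports "HOL-Probability.Probability"
begin

definition cube :: "nat \<Rightarrow> bool list set" where
  "cube n = {x. length x = n}"

text \<open>
  A function from the cube to \<open>{0,1}\<close> is given by an \<open>f :: bool list \<Rightarrow> bool\<close>, of which only
  the values on \<open>cube n\<close> matter. The following is the preimage of 1.
\<close>

definition sat :: "nat \<Rightarrow> (bool list \<Rightarrow> bool) \<Rightarrow> bool list set" where
  "sat n f = {x \<in> cube n. f x}"

definition Unate :: "nat \<Rightarrow> (bool list \<Rightarrow> bool) set" where
  "Unate n = {f. \<forall>i<n.
     (\<forall>x\<in>cube n. f (x[i := False]) \<le> f (x[i := True])) \<or>
     (\<forall>x\<in>cube n. f (x[i := False]) \<ge> f (x[i := True]))}"

definition reldist :: "nat \<Rightarrow> (bool list \<Rightarrow> bool) \<Rightarrow> (bool list \<Rightarrow> bool) \<Rightarrow> real" where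
  "reldist n f g = real (card (sym_diff (sat n f) (sat n g))) / real (card (sat n f))"

definition reldist_Unate :: "nat \<Rightarrow> (bool list \<Rightarrow> bool) \<Rightarrow> real" where
  "reldist_Unate n f = Min (reldist n f ` Unate n)"

text \<open>The minimum above is over a finite nonempty set of reals, hence a genuine minimum.\<close>

lemma finite_cube: "finite (cube n)"
proof -
  have "cube n = {x. set x \<subseteq> (UNIV :: bool set) \<and> length x = n}"
    by (auto simp: cube_def)
  then show ?thesis
    using finite_lists_length_eq[of "UNIV :: bool set" n] by simp
qed

lemma finite_reldist_image: "finite (reldist n f ` A)"
proof (rule finite_subset)
  show "reldist n f ` A \<subseteq>
      (\<lambda>S. real (card (sym_diff (sat n f) S)) / real (card (sat n f))) ` Pow (cube n)"
    by (auto simp: reldist_def sat_def)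
qed (simp add: finite_cube)

lemma reldist_Unate_attained: "\<exists>g\<in>Unate n. reldist_Unate n f = reldist n f g"
proof -
  have "(\<lambda>_. False) \<in> Unate n"
    by (simp add: Unate_def)
  then have "Min (reldist n f ` Unate n) \<in> reldist n f ` Unate n"
    by (intro Min_in finite_reldist_image) auto
  then show ?thesis
    by (auto simp: reldist_Unate_def)
qed

lemma reldist_Unate_le: "g \<in> Unate n \<Longrightarrow> reldist_Unate n f \<le> reldist n f g"
  by (auto simp: reldist_Unate_def intro!: Min_le finite_reldist_image)

text \<open>
  Randomized adaptive oracle algorithms, as well-founded interaction trees. A run either halts with
  a verdict (\<open>True\<close> is accept), queries the membership oracle, calls the sampling oracle, or
  draws a value from a distribution of its choice (its internal randomness, which is not charged).
  As usual for query complexity, no bound on computational resources is imposed.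
\<close>

datatype tester =
    Halt bool
  | Call_MQ "bool list" "bool \<Rightarrow> tester"
  | Call_SAMP "bool list \<Rightarrow> tester"
  | Draw "nat pmf" "nat \<Rightarrow> tester"

text \<open>Membership queries may only be made at points of the cube.\<close>

primrec valid_queries :: "nat \<Rightarrow> tester \<Rightarrow> bool" where
  "valid_queries n (Halt b) \<longleftrightarrow> True"
| "valid_queries n (Call_MQ x k) \<longleftrightarrow> x \<in> cube n \<and> (\<forall>b. valid_queries n (k b))"
| "valid_queries n (Call_SAMP k) \<longleftrightarrow> (\<forall>x\<in>cube n. valid_queries n (k x))"
| "valid_queries n (Draw p k) \<longleftrightarrow> (\<forall>r\<in>set_pmf p. valid_queries n (k r))"

text \<open>
  The joint distribution of the verdict and the total number of oracle calls made in a run on \<open>f\<close>.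
\<close>

primrec run :: "nat \<Rightarrow> (bool list \<Rightarrow> bool) \<Rightarrow> tester \<Rightarrow> (bool \<times> nat) pmf" where
  "run n f (Halt b) = return_pmf (b, 0)"
| "run n f (Call_MQ x k) = map_pmf (map_prod id Suc) (run n f (k (f x)))"
| "run n f (Call_SAMP k) =
     map_pmf (map_prod id Suc) (bind_pmf (pmf_of_set (sat n f)) (\<lambda>x. run n f (k x)))"
| "run n f (Draw p k) = bind_pmf p (\<lambda>r. run n f (k r))"

definition accept_prob :: "nat \<Rightarrow> (bool list \<Rightarrow> bool) \<Rightarrow> tester \<Rightarrow> real" where
  "accept_prob n f T = measure_pmf.prob (run n f T) {(b, c). b}"

definition reject_prob :: "nat \<Rightarrow> (bool list \<Rightarrow> bool) \<Rightarrow> tester \<Rightarrow> real" where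
  "reject_prob n f T = measure_pmf.prob (run n f T) {(b, c). \<not> b}"

text \<open>
  A quantity is soft-O of \<open>t\<close> if it is at most \<open>soft_bound C d t\<close> for some absolute constants
  \<open>C\<close> and \<open>d\<close>. The shift by 2 keeps the logarithmic factor at least 1 for all \<open>t \<ge> 0\<close>.
\<close>

definition soft_bound :: "real \<Rightarrow> nat \<Rightarrow> real \<Rightarrow> real" where
  "soft_bound C d t = C * t * log 2 (t + 2) ^ d"

end

theory Submission
  imports Defs
begin

text \<open>
  A trial draws two samples \<open>x\<close>, \<open>z\<close>, picks a random coordinate \<open>i\<close> in which they differ, and looks for
  an increasing and a decreasing edge in direction \<open>i\<close> among the edges at \<open>x\<close>, \<open>z\<close> and \<open>m\<close> further
  samples. If \<open>f\<close> is unate with favoured point \<open>a\<close>, all points between a satisfying \<open>x\<close> and \<open>a\<close> are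
  satisfying, so \<open>x\<close> differs from \<open>a\<close> in at most \<open>L = \<lfloor>log 2 N\<rfloor>\<close> coordinates; two samples that differ
  in more than \<open>2 * L\<close> coordinates are therefore a proof of non-unateness, and otherwise there are only
  \<open>2 * L\<close> choices of \<open>i\<close>, however large \<open>n\<close> is.

  Orient every coordinate towards the majority of the satisfying points. Sorting the satisfying set
  along all coordinates makes it unate at a cost of twice the number of edges against the orientation.
  If \<open>f\<close> is far from unate, then one of three things happens. Either many satisfying points are heavy,
  that is, far from the majority point on the biased coordinates (those where the minority is below
  one third): these are caught by their distance to a random sample. Or the light points have many
  edges against the majority in biased directions: these are caught by \<open>x\<close> and \<open>z\<close> alone, because an
  edge along the majority is found with constant probability. Or balanced directions contain many
  minority edges. A direction with a fraction \<open>w\<close> of them is exposed by \<open>m\<close> about \<open>1 / w\<close> samples, so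
  the values \<open>m = 2 ^ k\<close> are all tried, with a number of repetitions proportional to \<open>1 / 2 ^ k\<close>.
\<close>

section \<open>Sorting along the coordinates\<close>

definition flip :: "nat \<Rightarrow> bool list \<Rightarrow> bool list" where
  "flip i x = x[i := \<not> x ! i]"

lemma length_flip [simp]: "length (flip i x) = length x"
  by (simp add: flip_def)

lemma flip_in_cube [simp]: "flip i x \<in> cube n \<longleftrightarrow> x \<in> cube n"
  by (simp add: cube_def)

lemma flip_flip [simp]: "flip i (flip i x) = x"
  by (cases "i < length x") (simp_all add: flip_def list_update_beyond)

lemma inj_on_flip: "inj_on (flip i) X"
  by (metis flip_flip inj_onI)

lemma image_flipI: "flip i x \<in> X \<Longrightarrow> x \<in> flip i ` X"
  by (metis flip_flip imageI)

lemma flip_commute: "flip i (flip j x) = flip j (flip i x)"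
  by (cases "i = j") (simp_all add: flip_def list_update_swap)

lemma nth_flip_same [simp]: "x \<in> cube n \<Longrightarrow> i < n \<Longrightarrow> flip i x ! i \<longleftrightarrow> \<not> x ! i"
  by (simp add: flip_def cube_def)

lemma nth_flip_other [simp]: "i \<noteq> j \<Longrightarrow> flip i x ! j = x ! j"
  by (simp add: flip_def)

lemma list_update_flip:
  assumes "x \<in> cube n" "i < n"
  shows "x[i := b] = (if x ! i = b then x else flip i x)"
  using assms by (auto simp: flip_def list_update_same_conv cube_def)

text \<open>Bichromatic edges in direction \<open>i\<close> against the orientation
  \<open>a\<close>, each named by its endpoint in \<open>S\<close>. Only \<open>a i\<close> matters,
  so \<open>\<lambda>_. False\<close> and \<open>\<lambda>_. True\<close> pick out the increasing
  and the decreasing edges.\<close>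

definition viol :: "(nat \<Rightarrow> bool) \<Rightarrow> nat \<Rightarrow> bool list set \<Rightarrow> bool list set" where
  "viol a i S = {x \<in> S. x ! i \<noteq> a i \<and> flip i x \<notin> S}"

text \<open>The shifting operator: an edge in direction \<open>i\<close> with exactly one endpoint
  in \<open>S\<close> gets its element at the end with bit \<open>a i\<close>; all other edges stay
  as they are.\<close>

definition sort_dir :: "nat \<Rightarrow> (nat \<Rightarrow> bool) \<Rightarrow> nat \<Rightarrow> bool list set \<Rightarrow> bool list set" where
  "sort_dir n a i S =
     {x \<in> cube n. if x ! i = a i then x \<in> S \<or> flip i x \<in> S else x \<in> S \<and> flip i x \<in> S}"

lemma sort_dir_subset: "sort_dir n a i S \<subseteq> cube n"
  by (auto simp: sort_dir_def)

lemma finite_subset_cube: "S \<subseteq> cube n \<Longrightarrow> finite S"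
  using finite_cube finite_subset by blast

lemma viol_sort_dir_same: "S \<subseteq> cube n \<Longrightarrow> i < n \<Longrightarrow> viol a i (sort_dir n a i S) = {}"
  by (auto simp: viol_def sort_dir_def split: if_splits)

text \<open>Only violating edges change, and on each of them both endpoints switch
  membership.\<close>

lemma card_sym_diff_sort_dir:
  assumes "S \<subseteq> cube n" "i < n"
  shows "card (sym_diff S (sort_dir n a i S)) \<le> 2 * card (viol a i S)"
proof -
  have fin: "finite (viol a i S)"
    using finite_subset_cube[OF assms(1)] by (simp add: viol_def)
  have "sym_diff S (sort_dir n a i S) \<subseteq> viol a i S \<union> flip i ` viol a i S"
  proof
    fix x assume x: "x \<in> sym_diff S (sort_dir n a i S)"
    then have xc: "x \<in> cube n" using assms(1) by (auto simp: sort_dir_def)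
    have "x \<in> viol a i S \<or> flip i x \<in> viol a i S"
      using x xc assms by (auto simp: sort_dir_def viol_def split: if_splits)
    then show "x \<in> viol a i S \<union> flip i ` viol a i S"
      using image_flipI by blast
  qed
  then have "card (sym_diff S (sort_dir n a i S)) \<le> card (viol a i S \<union> flip i ` viol a i S)"
    by (intro card_mono) (simp_all add: fin)
  also have "\<dots> \<le> card (viol a i S) + card (flip i ` viol a i S)"
    by (rule card_Un_le)
  also have "card (flip i ` viol a i S) \<le> card (viol a i S)"
    by (rule card_image_le[OF fin])
  finally show ?thesis by simp
qed

text \<open>Prepares a comparison square by square: the points with the wrong bit \<open>j\<close>
  are paired along direction \<open>i\<close>, and a pair is indexed by its member with the wrong
  bit \<open>i\<close>.\<close>

lemma card_pair_sum:
  assumes "X \<subseteq> cube n" "i < n" "i \<noteq> j" "\<And>x. x \<in> X \<Longrightarrow> x ! j \<noteq> a j"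
  shows "card X =
    (\<Sum>x\<in>{x \<in> cube n. x ! j \<noteq> a j \<and> x ! i \<noteq> a i}. of_bool (x \<in> X) + of_bool (flip i x \<in> X))"
proof -
  let ?P = "{x \<in> cube n. x ! j \<noteq> a j \<and> x ! i \<noteq> a i}"
  have fP: "finite ?P" using finite_cube by simp
  have X: "X = {x \<in> ?P. x \<in> X} \<union> flip i ` {x \<in> ?P. flip i x \<in> X}"
  proof (intro equalityI subsetI)
    fix x assume x: "x \<in> X"
    show "x \<in> {x \<in> ?P. x \<in> X} \<union> flip i ` {x \<in> ?P. flip i x \<in> X}"
    proof (cases "x ! i = a i")
      case True
      then have "flip i x \<in> {x \<in> ?P. flip i x \<in> X}"
        using x assms by auto
      then show ?thesis using image_flipI by blast
    next
      case False
      then show ?thesis using x assms by auto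
    qed
  qed auto
  have "card X = card {x \<in> ?P. x \<in> X} + card (flip i ` {x \<in> ?P. flip i x \<in> X})"
    using assms(2) by (subst X, intro card_Un_disjoint) (auto simp: fP finite_cube)
  also have "card (flip i ` {x \<in> ?P. flip i x \<in> X}) = card {x \<in> ?P. flip i x \<in> X}"
    by (rule card_image[OF inj_on_flip])
  finally have "card X = card {x \<in> ?P. x \<in> X} + card {x \<in> ?P. flip i x \<in> X}" .
  moreover have "(\<Sum>x\<in>?P. of_bool (R x)) = card {x \<in> ?P. R x}" for R
    using fP by (simp add: of_bool_def sum.If_cases Int_def)
  ultimately show ?thesis
    by (simp only: sum.distrib)
qed

text \<open>Shifting acts inside each square spanned by the directions \<open>i\<close> and
  \<open>j\<close>, so it suffices to compare the two \<open>j\<close>-edges of a single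
  square.\<close>

lemma card_viol_sort_dir:
  assumes S: "S \<subseteq> cube n" and ij: "i < n" "j < n" "i \<noteq> j"
  shows "card (viol a j (sort_dir n a i S)) \<le> card (viol a j S)"
proof -
  let ?T = "sort_dir n a i S"
  have *: "card (viol a j U) =
    (\<Sum>x\<in>{x \<in> cube n. x ! j \<noteq> a j \<and> x ! i \<noteq> a i}.
       of_bool (x \<in> viol a j U) + of_bool (flip i x \<in> viol a j U))" if "U \<subseteq> cube n" for U
    using that ij by (intro card_pair_sum) (auto simp: viol_def)
  show ?thesis
    unfolding *[OF S] *[OF sort_dir_subset]
  proof (rule sum_mono)
    fix x assume "x \<in> {x \<in> cube n. x ! j \<noteq> a j \<and> x ! i \<noteq> a i}"
    then have x: "x \<in> cube n" "x ! j \<noteq> a j" "x ! i \<noteq> a i" by auto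
    have m: "x \<in> ?T \<longleftrightarrow> x \<in> S \<and> flip i x \<in> S"
      "flip i x \<in> ?T \<longleftrightarrow> x \<in> S \<or> flip i x \<in> S"
      "flip j x \<in> ?T \<longleftrightarrow> flip j x \<in> S \<and> flip i (flip j x) \<in> S"
      "flip i (flip j x) \<in> ?T \<longleftrightarrow> flip j x \<in> S \<or> flip i (flip j x) \<in> S"
      using x(1,3) ij(1,3) by (simp_all add: sort_dir_def disj_commute)
    show "of_bool (x \<in> viol a j ?T) + of_bool (flip i x \<in> viol a j ?T)
      \<le> (of_bool (x \<in> viol a j S) + of_bool (flip i x \<in> viol a j S) :: nat)"
    proof -
      have v: "x \<in> viol a j U \<longleftrightarrow> x \<in> U \<and> flip j x \<notin> U"
        "flip i x \<in> viol a j U \<longleftrightarrow> flip i x \<in> U \<and> flip i (flip j x) \<notin> U" for U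
        using x(2) ij(3) by (auto simp: viol_def flip_commute[of j i])
      \<comment> \<open>Everything is now a Boolean function of which corners of the square lie in
        \<open>S\<close>, leaving 16 cases.\<close>
      show ?thesis
        unfolding v m
        by (cases "x \<in> S"; cases "flip i x \<in> S"; cases "flip j x \<in> S";
            cases "flip i (flip j x) \<in> S") simp_all
    qed
  qed
qed

lemma card_sym_diff_triangle:
  assumes "finite A" "finite B" "finite C"
  shows "card (sym_diff A C) \<le> card (sym_diff A B) + card (sym_diff B C)"
proof -
  have "card (sym_diff A C) \<le> card (sym_diff A B \<union> sym_diff B C)"
    using assms by (intro card_mono) auto
  also have "\<dots> \<le> card (sym_diff A B) + card (sym_diff B C)"
    by (rule card_Un_le)
  finally show ?thesis .
qed

text \<open>No violation count ever grows, so directions sorted earlier stay clean and each step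
  costs at most twice the original count of its direction.\<close>

lemma sort_dirs:
  assumes S: "S \<subseteq> cube n" and "k \<le> n"
  shows "\<exists>T \<subseteq> cube n. (\<forall>i<n. card (viol a i T) \<le> card (viol a i S)) \<and> (\<forall>i<k. viol a i T = {}) \<and>
    card (sym_diff S T) \<le> 2 * (\<Sum>i<k. card (viol a i S))"
  using \<open>k \<le> n\<close>
proof (induction k)
  case 0
  then show ?case using S by (intro exI[of _ S]) auto
next
  case (Suc k)
  then obtain T where T: "T \<subseteq> cube n" "\<And>i. i < n \<Longrightarrow> card (viol a i T) \<le> card (viol a i S)"
    "\<And>i. i < k \<Longrightarrow> viol a i T = {}" "card (sym_diff S T) \<le> 2 * (\<Sum>i<k. card (viol a i S))"
    by auto
  let ?U = "sort_dir n a k T"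
  have k: "k < n" using Suc by simp
  have fin: "finite S" "finite T" "finite ?U"
    using S T(1) sort_dir_subset finite_subset_cube by metis+
  have fv: "finite (viol a i ?U)" for i using fin by (simp add: viol_def)
  have mono: "card (viol a i ?U) \<le> card (viol a i T)" if "i < n" for i
    using card_viol_sort_dir[OF T(1) k that] viol_sort_dir_same[OF T(1) k] by (cases "i = k") auto
  have empty: "viol a i ?U = {}" if "i < Suc k" for i
  proof (cases "i = k")
    case False
    then show ?thesis using mono[of i] that k T(3)[of i] fv by simp
  qed (simp add: viol_sort_dir_same[OF T(1) k])
  have "card (sym_diff S ?U) \<le> card (sym_diff S T) + card (sym_diff T ?U)"
    by (rule card_sym_diff_triangle[OF fin])
  moreover have "card (sym_diff T ?U) \<le> 2 * card (viol a k T)"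
    by (rule card_sym_diff_sort_dir[OF T(1) k])
  moreover have "(\<Sum>i<Suc k. card (viol a i S)) = (\<Sum>i<k. card (viol a i S)) + card (viol a k S)"
    by simp
  ultimately have "card (sym_diff S ?U) \<le> 2 * (\<Sum>i<Suc k. card (viol a i S))"
    using T(4) T(2)[OF k] by linarith
  moreover have "card (viol a i ?U) \<le> card (viol a i S)" if "i < n" for i
    using mono[OF that] T(2)[OF that] by linarith
  ultimately show ?case
    by (intro exI[of _ ?U] conjI allI impI sort_dir_subset empty) simp_all
qed

lemma unate_repair:
  assumes S: "S \<subseteq> cube n"
  shows "\<exists>g\<in>Unate n. card (sym_diff S (sat n g)) \<le> 2 * (\<Sum>i<n. card (viol a i S))"
proof -
  obtain T where T: "T \<subseteq> cube n" "\<And>i. i < n \<Longrightarrow> viol a i T = {}"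
    "card (sym_diff S T) \<le> 2 * (\<Sum>i<n. card (viol a i S))"
    using sort_dirs[OF S order_refl] by metis
  have "sat n (\<lambda>x. x \<in> T) = T" using T(1) by (auto simp: sat_def)
  moreover have "(\<lambda>x. x \<in> T) \<in> Unate n"
    unfolding Unate_def mem_Collect_eq
  proof (intro allI impI)
    fix i assume i: "i < n"
    have up: "x ! i \<noteq> a i \<Longrightarrow> x \<in> T \<Longrightarrow> flip i x \<in> T" for x
      using T(2)[OF i] by (auto simp: viol_def)
    show "(\<forall>x\<in>cube n. (x[i := False] \<in> T) \<le> (x[i := True] \<in> T)) \<or>
         (\<forall>x\<in>cube n. (x[i := False] \<in> T) \<ge> (x[i := True] \<in> T))"
    proof (cases "a i")
      case True
      then have "x[i := False] \<in> T \<longrightarrow> x[i := True] \<in> T" if "x \<in> cube n" for x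
        using up[of x] up[of "flip i x"] that i by (cases "x ! i") (simp_all add: list_update_flip)
      then show ?thesis by auto
    next
      case False
      then have "x[i := True] \<in> T \<longrightarrow> x[i := False] \<in> T" if "x \<in> cube n" for x
        using up[of x] up[of "flip i x"] that i by (cases "x ! i") (simp_all add: list_update_flip)
      then show ?thesis by auto
    qed
  qed
  ultimately show ?thesis using T(3) by (intro bexI[of _ "\<lambda>x. x \<in> T"]) simp_all
qed

section \<open>Orientations of unate functions\<close>

lemma unate_oriented:
  assumes "f \<in> Unate n"
  obtains a where "\<And>i. i < n \<Longrightarrow> viol a i (sat n f) = {}"
proof -
  have "\<exists>b. \<forall>x\<in>sat n f. x ! i \<noteq> b \<longrightarrow> flip i x \<in> sat n f" if i: "i < n" for i
  proof -
    have "(\<forall>x\<in>cube n. f (x[i := False]) \<le> f (x[i := True])) \<or>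
     (\<forall>x\<in>cube n. f (x[i := False]) \<ge> f (x[i := True]))"
      using assms i by (simp add: Unate_def)
    then show ?thesis
    proof
      assume *: "\<forall>x\<in>cube n. f (x[i := False]) \<le> f (x[i := True])"
      have "flip i x \<in> sat n f" if "x \<in> sat n f" "\<not> x ! i" for x
        using * that list_update_flip[of x n i] i by (auto simp: sat_def)
      then show ?thesis by (intro exI[of _ True]) auto
    next
      assume *: "\<forall>x\<in>cube n. f (x[i := False]) \<ge> f (x[i := True])"
      have "flip i x \<in> sat n f" if "x \<in> sat n f" "x ! i" for x
        using * that list_update_flip[of x n i] i by (auto simp: sat_def)
      then show ?thesis by (intro exI[of _ False]) auto
    qed
  qed
  then obtain a where "\<And>i. i < n \<Longrightarrow> \<forall>x\<in>sat n f. x ! i \<noteq> a i \<longrightarrow> flip i x \<in> sat n f"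
    by metis
  then show ?thesis by (intro that[of a]) (auto simp: viol_def)
qed

text \<open>All points obtained from \<open>x\<close> by moving coordinates in their favoured direction lie in \<open>S\<close>.\<close>

lemma two_power_card_le:
  assumes S: "S \<subseteq> cube n" and a: "\<And>i. i < n \<Longrightarrow> viol a i S = {}" and x: "x \<in> S"
  shows "2 ^ card {i. i < n \<and> x ! i \<noteq> a i} \<le> card S"
proof -
  let ?Z = "{i. i < n \<and> x ! i \<noteq> a i}"
  \<comment> \<open>\<open>y W\<close> is \<open>x\<close> with the bits in \<open>W\<close>
    flipped. Distinct \<open>W \<subseteq> ?Z\<close> give distinct points, all of them in
    \<open>S\<close>.\<close>
  define y where "y W = map (\<lambda>i. if i \<in> W then \<not> x ! i else x ! i) [0..<n]" for W
  have len: "length x = n" using x S by (auto simp: cube_def)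
  have yn: "y W ! i \<longleftrightarrow> (if i \<in> W then \<not> x ! i else x ! i)" if "i < n" for W i
    using that by (simp add: y_def)
  have y_in: "y W \<in> S" if "finite W" "W \<subseteq> ?Z" for W
    using that
  proof (induction W rule: finite_induct)
    case empty
    have "y {} = x" using len by (intro nth_equalityI) (auto simp: y_def)
    then show ?case using x by simp
  next
    case (insert i W)
    then have i: "i < n" "x ! i \<noteq> a i" and W: "y W \<in> S" by auto
    have "y (insert i W) = flip i (y W)"
      using insert(2) i by (intro nth_equalityI) (auto simp: y_def flip_def nth_list_update)
    moreover have "y W ! i \<noteq> a i" using i insert(2) yn by simp
    ultimately show ?case using W a[OF i(1)] by (auto simp: viol_def)
  qed
  have inj: "inj_on y (Pow ?Z)"
  proof (rule inj_onI)
    fix V W assume "V \<in> Pow ?Z" "W \<in> Pow ?Z" and eq: "y V = y W"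
    moreover have "i \<in> V \<longleftrightarrow> i \<in> W" if "i < n" for i
      using yn[OF that, of V] yn[OF that, of W] eq by (auto split: if_splits)
    ultimately show "V = W" by blast
  qed
  have "2 ^ card ?Z = card (y ` Pow ?Z)"
    by (subst card_image[OF inj]) (simp add: card_Pow)
  also have "\<dots> \<le> card S"
    using finite_subset_cube[OF S] y_in finite_subset[of _ ?Z] by (intro card_mono) auto
  finally show ?thesis .
qed

section \<open>The tester\<close>

lemma accept_prob_nonneg: "0 \<le> accept_prob n f T"
  by (simp add: accept_prob_def)

lemma reject_prob_eq: "reject_prob n f T = 1 - accept_prob n f T"
proof -
  have "{(b, c). \<not> b} = space (measure_pmf (run n f T)) - {(b, c). b}" by auto
  then show ?thesis
    unfolding reject_prob_def accept_prob_def by (simp only: measure_pmf.prob_compl sets_measure_pmf UNIV_I)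
qed

lemma accept_prob_eq_pmf: "accept_prob n f T = pmf (map_pmf fst (run n f T)) True"
  by (simp add: accept_prob_def pmf_map vimage_def case_prod_beta')

lemma accept_prob_Halt [simp]: "accept_prob n f (Halt b) = of_bool b"
  by (simp add: accept_prob_eq_pmf)

lemma accept_prob_Call_MQ [simp]: "accept_prob n f (Call_MQ x k) = accept_prob n f (k (f x))"
  by (simp add: accept_prob_eq_pmf pmf.map_comp comp_def)

lemma finite_sat [simp]: "finite (sat n f)"
  using finite_cube by (simp add: sat_def)

lemma accept_prob_Call_SAMP:
  assumes "sat n f \<noteq> {}"
  shows "accept_prob n f (Call_SAMP k) =
    (\<Sum>x\<in>sat n f. accept_prob n f (k x)) / card (sat n f)"
  using assms
  by (simp add: accept_prob_eq_pmf pmf.map_comp comp_def map_bind_pmf pmf_bind_pmf_of_set)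

lemma accept_prob_Draw_of_set:
  assumes "finite J" "J \<noteq> {}"
  shows "accept_prob n f (Draw (pmf_of_set J) k) = (\<Sum>j\<in>J. accept_prob n f (k j)) / card J"
  using assms by (simp add: accept_prob_eq_pmf map_bind_pmf pmf_bind_pmf_of_set)

definition calls_le :: "nat \<Rightarrow> (bool list \<Rightarrow> bool) \<Rightarrow> tester \<Rightarrow> nat \<Rightarrow> bool" where
  "calls_le n f T c \<longleftrightarrow> (\<forall>(b, k)\<in>set_pmf (run n f T). k \<le> c)"

lemma calls_le_Halt: "calls_le n f (Halt b) c"
  by (simp add: calls_le_def)

lemma calls_le_Call_MQ: "calls_le n f (k (f x)) c \<Longrightarrow> calls_le n f (Call_MQ x k) (Suc c)"
  by (fastforce simp: calls_le_def)

lemma calls_le_Call_SAMP: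
  "sat n f \<noteq> {} \<Longrightarrow> (\<And>x. x \<in> sat n f \<Longrightarrow> calls_le n f (k x) c) \<Longrightarrow>
    calls_le n f (Call_SAMP k) (Suc c)"
  by (auto simp: calls_le_def set_pmf_of_set case_prod_beta)

lemma calls_le_Draw:
  "(\<And>r. r \<in> set_pmf p \<Longrightarrow> calls_le n f (k r) c) \<Longrightarrow> calls_le n f (Draw p k) c"
  by (fastforce simp: calls_le_def)

lemma calls_le_mono: "calls_le n f T c \<Longrightarrow> c \<le> c' \<Longrightarrow> calls_le n f T c'"
  by (fastforce simp: calls_le_def)

text \<open>A list rather than a set, so that a random index can select a coordinate.\<close>

definition diff_coords :: "nat \<Rightarrow> bool list \<Rightarrow> bool list \<Rightarrow> nat list" where
  "diff_coords n x z = filter (\<lambda>i. x ! i \<noteq> z ! i) [0..<n]"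

lemma set_diff_coords: "set (diff_coords n x z) = {i. i < n \<and> x ! i \<noteq> z ! i}"
  by (auto simp: diff_coords_def)

lemma distinct_diff_coords: "distinct (diff_coords n x z)"
  by (simp add: diff_coords_def)

text \<open>The flags record whether an increasing, respectively a decreasing, edge has been seen.\<close>

primrec probes :: "nat \<Rightarrow> tester \<Rightarrow> nat \<Rightarrow> bool \<Rightarrow> bool \<Rightarrow> tester" where
  "probes i T 0 up dn = (if up \<and> dn then Halt False else T)"
| "probes i T (Suc m) up dn = Call_SAMP (\<lambda>y. Call_MQ (flip i y) (\<lambda>b.
     probes i T m (up \<or> y ! i \<and> \<not> b) (dn \<or> \<not> y ! i \<and> \<not> b)))"

text \<open>As \<open>x\<close> and \<open>z\<close> differ in bit \<open>i\<close>, two unsatisfied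
  neighbours mean one increasing and one decreasing edge. The probes start with clear flags, so
  their outcome does not depend on \<open>x\<close> and \<open>z\<close>.\<close>

definition edge_check :: "nat \<Rightarrow> bool list \<Rightarrow> bool list \<Rightarrow> nat \<Rightarrow> tester \<Rightarrow> tester" where
  "edge_check i x z m T = Call_MQ (flip i x) (\<lambda>b. Call_MQ (flip i z) (\<lambda>c.
     if \<not> b \<and> \<not> c then Halt False else probes i T m False False))"

text \<open>
  Of the \<open>4 * L\<close> values of \<open>j\<close> at most half select a coordinate. Hence the rejections caused by
  \<open>length (diff_coords n x z) > 2 * L\<close> always outweigh the edges they hide from a point with at most
  \<open>4 * L\<close> candidate coordinates.
\<close>

definition trial :: "nat \<Rightarrow> nat \<Rightarrow> nat \<Rightarrow> tester \<Rightarrow> tester" where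
  "trial n L m T = Call_SAMP (\<lambda>x. Call_SAMP (\<lambda>z.
     if length (diff_coords n x z) > 2 * L then Halt False
     else Draw (pmf_of_set {..<4 * L}) (\<lambda>j.
       if j < length (diff_coords n x z) then edge_check (diff_coords n x z ! j) x z m T else T)))"

definition trials :: "nat \<Rightarrow> nat \<Rightarrow> nat list \<Rightarrow> tester" where
  "trials n L ms = foldr (trial n L) ms (Halt True)"

lemma valid_probes: "valid_queries n T \<Longrightarrow> valid_queries n (probes i T m up dn)"
  by (induction m arbitrary: up dn) auto

lemma valid_trial: "valid_queries n T \<Longrightarrow> valid_queries n (trial n L m T)"
  by (auto simp: trial_def edge_check_def valid_probes)

lemma valid_trials: "valid_queries n (trials n L ms)"
  unfolding trials_def by (induction ms) (auto simp: valid_trial)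

lemma calls_probes:
  assumes "sat n f \<noteq> {}" "calls_le n f T c"
  shows "calls_le n f (probes i T m up dn) (2 * m + c)"
proof (induction m arbitrary: up dn)
  case 0
  then show ?case using assms by (simp add: calls_le_Halt)
next
  case (Suc m)
  have "calls_le n f (probes i T (Suc m) up dn) (Suc (Suc (2 * m + c)))"
    unfolding probes.simps by (intro calls_le_Call_SAMP calls_le_Call_MQ Suc assms(1))
  then show ?case by simp
qed

text \<open>Besides the probes there are two samples and two membership queries, at neighbours of
  these samples.\<close>

lemma calls_trial:
  assumes "sat n f \<noteq> {}" "calls_le n f T c"
  shows "calls_le n f (trial n L m T) (2 * m + 4 + c)"
proof -
  have "calls_le n f (edge_check i x z m T) (Suc (Suc (2 * m + c)))" for i x z
    unfolding edge_check_def
    by (intro calls_le_Call_MQ) (simp add: calls_le_Halt calls_probes[OF assms])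
  moreover have "calls_le n f T (Suc (Suc (2 * m + c)))"
    using assms(2) by (rule calls_le_mono) simp
  ultimately have "calls_le n f (trial n L m T) (Suc (Suc (Suc (Suc (2 * m + c)))))"
    unfolding trial_def
    by (intro calls_le_Call_SAMP assms(1)) (auto intro!: calls_le_Draw simp: calls_le_Halt)
  then show ?thesis by (simp add: numeral_eq_Suc)
qed

lemma calls_trials:
  assumes "sat n f \<noteq> {}"
  shows "calls_le n f (trials n L ms) (\<Sum>m\<leftarrow>ms. 2 * m + 4)"
  unfolding trials_def
proof (induction ms)
  case Nil
  then show ?case by (simp add: calls_le_Halt)
next
  case (Cons m ms)
  then show ?case using calls_trial[OF assms Cons] by (simp add: add.assoc)
qed

section \<open>Completeness: unate functions are never rejected\<close>

lemma accept_probes_no_up: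
  assumes "sat n f \<noteq> {}" "viol (\<lambda>_. False) i (sat n f) = {}"
  shows "accept_prob n f (probes i T m False dn) = accept_prob n f T"
proof (induction m arbitrary: dn)
  case (Suc m)
  have "accept_prob n f (probes i T m (y ! i \<and> \<not> f (flip i y)) (dn \<or> \<not> y ! i \<and> \<not> f (flip i y)))
      = accept_prob n f T" if "y \<in> sat n f" for y
  proof -
    have "\<not> (y ! i \<and> \<not> f (flip i y))"
      using assms(2) that by (auto simp: viol_def sat_def)
    then show ?thesis using Suc by (simp only: simp_thms)
  qed
  then show ?case using assms(1) by (simp add: accept_prob_Call_SAMP)
qed simp

lemma accept_probes_no_down:
  assumes "sat n f \<noteq> {}" "viol (\<lambda>_. True) i (sat n f) = {}"
  shows "accept_prob n f (probes i T m up False) = accept_prob n f T"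
proof (induction m arbitrary: up)
  case (Suc m)
  have "accept_prob n f (probes i T m (up \<or> y ! i \<and> \<not> f (flip i y)) (\<not> y ! i \<and> \<not> f (flip i y)))
      = accept_prob n f T" if "y \<in> sat n f" for y
  proof -
    have "\<not> (\<not> y ! i \<and> \<not> f (flip i y))"
      using assms(2) that by (auto simp: viol_def sat_def)
    then show ?thesis using Suc by (simp only: simp_thms)
  qed
  then show ?case using assms(1) by (simp add: accept_prob_Call_SAMP)
qed simp

text \<open>One of \<open>x\<close> and \<open>z\<close> has the unfavoured bit, so its neighbour is
  satisfying. The probes never set both flags, because one kind of edge does not exist.\<close>

lemma accept_edge_check_unate:
  assumes S: "sat n f \<noteq> {}" and i: "i < n" "viol a i (sat n f) = {}"
    and xz: "x \<in> sat n f" "z \<in> sat n f" "x ! i \<noteq> z ! i"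
  shows "accept_prob n f (edge_check i x z m T) = accept_prob n f T"
proof -
  have "f (flip i x) \<or> f (flip i z)"
    using i xz by (auto simp: viol_def sat_def)
  moreover have "accept_prob n f (probes i T m False False) = accept_prob n f T"
    using accept_probes_no_up[OF S] accept_probes_no_down[OF S] i(2)
    by (cases "a i") (simp_all add: viol_def)
  ultimately show ?thesis by (auto simp: edge_check_def)
qed

text \<open>Each point is within distance \<open>L\<close> of the favoured point by
  \<open>two_power_card_le\<close>; the triangle inequality does the rest.\<close>

lemma length_diff_coords_unate:
  assumes "sat n f \<noteq> {}" and a: "\<And>i. i < n \<Longrightarrow> viol a i (sat n f) = {}"
    and L: "card (sat n f) < 2 ^ Suc L" and xz: "x \<in> sat n f" "z \<in> sat n f"
  shows "length (diff_coords n x z) \<le> 2 * L"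
proof -
  have *: "card {i. i < n \<and> y ! i \<noteq> a i} \<le> L" if "y \<in> sat n f" for y
  proof -
    have "2 ^ card {i. i < n \<and> y ! i \<noteq> a i} \<le> card (sat n f)"
      by (intro two_power_card_le[of _ n] a that) (auto simp: sat_def)
    then have "(2::nat) ^ card {i. i < n \<and> y ! i \<noteq> a i} < 2 ^ Suc L" using L by linarith
    then show ?thesis by (simp add: power_strict_increasing_iff less_Suc_eq_le del: power_Suc)
  qed
  have "length (diff_coords n x z) = card {i. i < n \<and> x ! i \<noteq> z ! i}"
    using distinct_card[OF distinct_diff_coords] by (metis set_diff_coords)
  also have "\<dots> \<le> card ({i. i < n \<and> x ! i \<noteq> a i} \<union> {i. i < n \<and> z ! i \<noteq> a i})"
    by (intro card_mono) auto
  also have "\<dots> \<le> L + L"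
    by (rule order_trans[OF card_Un_le add_mono[OF *[OF xz(1)] *[OF xz(2)]]])
  finally show ?thesis by simp
qed

lemma accept_trials_unate:
  assumes S: "sat n f \<noteq> {}" and f: "f \<in> Unate n"
    and L: "card (sat n f) < 2 ^ Suc L" "L > 0"
  shows "accept_prob n f (trials n L ms) = 1"
proof -
  obtain a where a: "\<And>i. i < n \<Longrightarrow> viol a i (sat n f) = {}"
    using unate_oriented[OF f] by blast
  have "accept_prob n f (trial n L m T) = accept_prob n f T" for m T
  proof -
    have e: "accept_prob n f (edge_check (diff_coords n x z ! j) x z m T) = accept_prob n f T"
      if "x \<in> sat n f" "z \<in> sat n f" "j < length (diff_coords n x z)" for x z j
    proof -
      have "diff_coords n x z ! j \<in> {i. i < n \<and> x ! i \<noteq> z ! i}"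
        using that(3) set_diff_coords nth_mem by metis
      then show ?thesis using that by (intro accept_edge_check_unate[OF S _ a]) auto
    qed
    have "accept_prob n f (Draw (pmf_of_set {..<4 * L}) (\<lambda>j.
       if j < length (diff_coords n x z) then edge_check (diff_coords n x z ! j) x z m T else T))
       = accept_prob n f T" if "x \<in> sat n f" "z \<in> sat n f" for x z
    proof -
      have "accept_prob n f (Draw (pmf_of_set {..<4 * L}) (\<lambda>j.
         if j < length (diff_coords n x z) then edge_check (diff_coords n x z ! j) x z m T else T))
         = (\<Sum>j<4 * L. accept_prob n f (if j < length (diff_coords n x z)
              then edge_check (diff_coords n x z ! j) x z m T else T)) / card {..<4 * L}"
        using L(2) by (intro accept_prob_Draw_of_set) (auto simp: lessThan_empty_iff)
      also have "\<dots> = (\<Sum>j<4 * L. accept_prob n f T) / card {..<4 * L}"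
        using e[OF that] by (intro arg_cong2[where f = "(/)"] sum.cong refl) simp
      finally have "accept_prob n f (Draw (pmf_of_set {..<4 * L}) (\<lambda>j.
         if j < length (diff_coords n x z) then edge_check (diff_coords n x z ! j) x z m T else T))
         = (\<Sum>j<4 * L. accept_prob n f T) / card {..<4 * L}" .
      then show ?thesis using L(2) by simp
    qed
    then show ?thesis
      using length_diff_coords_unate[OF S a L(1)] S
      by (simp add: trial_def accept_prob_Call_SAMP leD)
  qed
  then show ?thesis unfolding trials_def by (induction ms) simp_all
qed

section \<open>Rejection probability of a trial\<close>

lemma sum_of_bool_mem:
  assumes "finite S" "V \<subseteq> S"
  shows "(\<Sum>y\<in>S. of_bool (y \<in> V)) = real (card V)"
  using assms by (simp add: of_bool_def sum.If_cases Int_absorb1)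

text \<open>The probability that a sample exposes an increasing (\<open>b = False\<close>) or a
  decreasing (\<open>b = True\<close>) edge in direction \<open>i\<close>.\<close>

definition edge_freq :: "nat \<Rightarrow> (bool list \<Rightarrow> bool) \<Rightarrow> bool \<Rightarrow> nat \<Rightarrow> real" where
  "edge_freq n f b i = card (viol (\<lambda>_. b) i (sat n f)) / card (sat n f)"

text \<open>A lower bound for the probability that \<open>m\<close> samples expose both kinds of
  edges: a union bound over the kind that is missed, cut off at 0.\<close>

definition hit :: "nat \<Rightarrow> (bool list \<Rightarrow> bool) \<Rightarrow> nat \<Rightarrow> nat \<Rightarrow> real" where
  "hit n f i m = 1 - min 1 (2 * (1 - min (edge_freq n f False i) (edge_freq n f True i)) ^ m)"

text \<open>
  \<open>gain\<close> bounds from below the rejection probability of a trial whose first two samples are \<open>x\<close> and \<open>z\<close>.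
\<close>

definition gain :: "nat \<Rightarrow> (bool list \<Rightarrow> bool) \<Rightarrow> nat \<Rightarrow> nat \<Rightarrow> bool list \<Rightarrow> bool list \<Rightarrow> real" where
  "gain n f L m x z = (if length (diff_coords n x z) > 2 * L then 1 else
     (\<Sum>i\<in>set (diff_coords n x z).
        if \<not> f (flip i x) \<and> \<not> f (flip i z) then 1 else hit n f i m) / (4 * L))"

definition trial_gain :: "nat \<Rightarrow> (bool list \<Rightarrow> bool) \<Rightarrow> nat \<Rightarrow> nat \<Rightarrow> real" where
  "trial_gain n f L m = (\<Sum>x\<in>sat n f. \<Sum>z\<in>sat n f. gain n f L m x z) / (card (sat n f))\<^sup>2"

lemma viol_subset: "viol a i S \<subseteq> S"
  by (auto simp: viol_def)

lemma hit_nonneg: "0 \<le> hit n f i m"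
  by (simp add: hit_def)

lemma edge_freq_nonneg: "0 \<le> edge_freq n f b i"
  by (simp add: edge_freq_def)

lemma edge_freq_le_1: "edge_freq n f b i \<le> 1"
  using card_mono[OF finite_sat viol_subset]
  by (auto simp: edge_freq_def divide_le_eq_1)

lemma hit_le_1: "hit n f i m \<le> 1"
  using edge_freq_le_1[of n f False i] by (simp add: hit_def min_def)

lemma gain_nonneg: "0 \<le> gain n f L m x z"
  by (auto simp: gain_def hit_nonneg intro!: sum_nonneg divide_nonneg_nonneg)

lemma accept_probes_both:
  assumes "sat n f \<noteq> {}"
  shows "accept_prob n f (probes i T m True True) = 0"
  using assms by (induction m) (simp_all add: accept_prob_Call_SAMP)

lemma mem_viol_sat:
  "y \<in> viol (\<lambda>_. b) i (sat n f) \<longleftrightarrow> y \<in> sat n f \<and> y ! i \<noteq> b \<and> \<not> f (flip i y)"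
  by (auto simp: viol_def sat_def)

text \<open>Only a decreasing edge is still missing, and the samples miss it independently.\<close>

lemma accept_probes_up:
  assumes S: "sat n f \<noteq> {}"
  shows "accept_prob n f (probes i T m True False) = (1 - edge_freq n f True i) ^ m * accept_prob n f T"
proof (induction m)
  case (Suc m)
  let ?S = "sat n f" and ?V = "viol (\<lambda>_. True) i (sat n f)"
  let ?q = "(1 - edge_freq n f True i) ^ m * accept_prob n f T"
  have N: "card ?S > 0" using S by (simp add: card_gt_0_iff)
  have "accept_prob n f (probes i T m True (\<not> y ! i \<and> \<not> f (flip i y)))
    = (1 - of_bool (y \<in> ?V)) * ?q" if "y \<in> ?S" for y
    using that Suc accept_probes_both[OF S, of i T m]
    unfolding mem_viol_sat by (cases "y ! i"; cases "f (flip i y)") simp_all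
  then have "accept_prob n f (probes i T (Suc m) True False)
    = (\<Sum>y\<in>?S. (1 - of_bool (y \<in> ?V)) * ?q) / card ?S"
    using S by (simp add: accept_prob_Call_SAMP cong: sum.cong)
  also have "\<dots> = (real (card ?S) - card ?V) * ?q / card ?S"
    unfolding sum_distrib_right[symmetric]
    by (simp only: sum_subtractf sum_of_bool_mem[OF finite_sat viol_subset]) simp
  also have "\<dots> = (1 - edge_freq n f True i) * ?q"
  proof -
    have "1 - edge_freq n f True i = (real (card ?S) - card ?V) / card ?S"
      using S by (simp add: edge_freq_def diff_divide_distrib)
    then show ?thesis by (simp only: times_divide_eq_left)
  qed
  finally show ?case by (simp add: mult.assoc)
qed simp

lemma accept_probes_down:
  assumes S: "sat n f \<noteq> {}"
  shows "accept_prob n f (probes i T m False True) = (1 - edge_freq n f False i) ^ m * accept_prob n f T"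
proof (induction m)
  case (Suc m)
  let ?S = "sat n f" and ?V = "viol (\<lambda>_. False) i (sat n f)"
  let ?q = "(1 - edge_freq n f False i) ^ m * accept_prob n f T"
  have N: "card ?S > 0" using S by (simp add: card_gt_0_iff)
  have "accept_prob n f (probes i T m (y ! i \<and> \<not> f (flip i y)) True)
    = (1 - of_bool (y \<in> ?V)) * ?q" if "y \<in> ?S" for y
    using that Suc accept_probes_both[OF S, of i T m]
    unfolding mem_viol_sat by (cases "y ! i"; cases "f (flip i y)") simp_all
  then have "accept_prob n f (probes i T (Suc m) False True)
    = (\<Sum>y\<in>?S. (1 - of_bool (y \<in> ?V)) * ?q) / card ?S"
    using S by (simp add: accept_prob_Call_SAMP cong: sum.cong)
  also have "\<dots> = (real (card ?S) - card ?V) * ?q / card ?S"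
    unfolding sum_distrib_right[symmetric]
    by (simp only: sum_subtractf sum_of_bool_mem[OF finite_sat viol_subset]) simp
  also have "\<dots> = (1 - edge_freq n f False i) * ?q"
  proof -
    have "1 - edge_freq n f False i = (real (card ?S) - card ?V) / card ?S"
      using S by (simp add: edge_freq_def diff_divide_distrib)
    then show ?thesis by (simp only: times_divide_eq_left)
  qed
  finally show ?case by (simp add: mult.assoc)
qed simp

text \<open>Inclusion-exclusion over never seeing an increasing edge and never seeing a decreasing
  one. A single sample shows at most one kind, so it shows neither with probability
  \<open>1 - u - d\<close>.\<close>

lemma accept_probes_none:
  fixes i :: nat
  assumes S: "sat n f \<noteq> {}"
  defines "u \<equiv> edge_freq n f False i" and "d \<equiv> edge_freq n f True i"
  shows "accept_prob n f (probes i T m False False)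
    = ((1 - u) ^ m + (1 - d) ^ m - (1 - u - d) ^ m) * accept_prob n f T"
proof (induction m)
  case (Suc m)
  let ?S = "sat n f" and ?U = "viol (\<lambda>_. False) i (sat n f)" and ?D = "viol (\<lambda>_. True) i (sat n f)"
  let ?A = "accept_prob n f T"
  let ?p = "(1 - d) ^ m * ?A" and ?q = "(1 - u) ^ m * ?A"
  let ?r = "((1 - u) ^ m + (1 - d) ^ m - (1 - u - d) ^ m) * ?A"
  have N: "card ?S > 0" using S by (simp add: card_gt_0_iff)
  have step: "accept_prob n f (probes i T m (y ! i \<and> \<not> f (flip i y)) (\<not> y ! i \<and> \<not> f (flip i y)))
    = of_bool (y \<in> ?U) * (?p - ?r) + of_bool (y \<in> ?D) * (?q - ?r) + ?r" if "y \<in> ?S" for y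
    using that Suc accept_probes_up[OF S, of i T m] accept_probes_down[OF S, of i T m]
    unfolding mem_viol_sat u_def d_def by (cases "y ! i"; cases "f (flip i y)") simp_all
  have "accept_prob n f (probes i T (Suc m) False False)
    = (\<Sum>y\<in>?S. of_bool (y \<in> ?U) * (?p - ?r) + of_bool (y \<in> ?D) * (?q - ?r) + ?r) / card ?S"
    using S step by (simp add: accept_prob_Call_SAMP cong: sum.cong)
  also have "\<dots> = (card ?U * (?p - ?r) + card ?D * (?q - ?r) + card ?S * ?r) / card ?S"
    by (simp only: sum.distrib sum_distrib_right[symmetric] sum_constant
        sum_of_bool_mem[OF finite_sat viol_subset]) (simp only: mult.assoc)
  also have "\<dots> = u * (?p - ?r) + d * (?q - ?r) + ?r"
    using S by (simp add: u_def d_def edge_freq_def add_divide_distrib)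
  also have "\<dots> = ((1 - u) ^ Suc m + (1 - d) ^ Suc m - (1 - u - d) ^ Suc m) * ?A"
    by (simp add: algebra_simps)
  finally show ?case .
qed simp

lemma edge_freq_sum_le_1: "edge_freq n f False i + edge_freq n f True i \<le> 1"
proof -
  let ?U = "viol (\<lambda>_. False) i (sat n f)" and ?D = "viol (\<lambda>_. True) i (sat n f)"
  have "card ?U + card ?D = card (?U \<union> ?D)"
    by (intro card_Un_disjoint[symmetric]) (auto simp: viol_def)
  also have "\<dots> \<le> card (sat n f)"
    by (intro card_mono) (auto simp: viol_def)
  finally show ?thesis
    unfolding edge_freq_def add_divide_distrib[symmetric]
    by (cases "sat n f = {}") (simp_all add: divide_le_eq_1 card_gt_0_iff flip: of_nat_add)
qed

lemma accept_probes_le: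
  assumes S: "sat n f \<noteq> {}"
  shows "accept_prob n f (probes i T m False False) \<le> (1 - hit n f i m) * accept_prob n f T"
proof -
  define u d where "u = edge_freq n f False i" and "d = edge_freq n f True i"
  have ud: "0 \<le> u" "0 \<le> d" "u + d \<le> 1"
    using edge_freq_nonneg edge_freq_sum_le_1 by (simp_all add: u_def d_def)
  \<comment> \<open>The recursion writes the value for \<open>Suc m\<close> as a convex combination
    of quantities at most 1.\<close>
  have "(1 - u) ^ m + (1 - d) ^ m - (1 - u - d) ^ m \<le> 1"
  proof (induction m)
    case (Suc m)
    have "(1 - u) ^ Suc m + (1 - d) ^ Suc m - (1 - u - d) ^ Suc m =
      u * (1 - d) ^ m + d * (1 - u) ^ m +
      (1 - u - d) * ((1 - u) ^ m + (1 - d) ^ m - (1 - u - d) ^ m)"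
      by (simp add: algebra_simps)
    also have "\<dots> \<le> u * 1 + d * 1 + (1 - u - d) * 1"
      using ud Suc by (intro add_mono mult_left_mono power_le_one) auto
    finally show ?case by simp
  qed simp
  moreover have "(1 - u) ^ m \<le> (1 - min u d) ^ m" "(1 - d) ^ m \<le> (1 - min u d) ^ m"
    using ud by (intro power_mono; simp)+
  moreover have "0 \<le> (1 - u - d) ^ m" using ud by simp
  ultimately have "(1 - u) ^ m + (1 - d) ^ m - (1 - u - d) ^ m \<le> min 1 (2 * (1 - min u d) ^ m)"
    by simp
  then show ?thesis
    unfolding accept_probes_none[OF S] hit_def u_def d_def
    by (simp add: accept_prob_nonneg mult_right_mono)
qed

lemma accept_edge_check_le:
  assumes "sat n f \<noteq> {}"
  shows "accept_prob n f (edge_check i x z m T) \<le>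
    (1 - (if \<not> f (flip i x) \<and> \<not> f (flip i z) then 1 else hit n f i m)) * accept_prob n f T"
  using accept_probes_le[OF assms, of i T m] by (simp add: edge_check_def)

lemma sum_nth_if_less:
  fixes h :: "nat \<Rightarrow> real"
  assumes "distinct xs" "length xs \<le> M"
  shows "(\<Sum>j<M. if j < length xs then h (xs ! j) else 0) = (\<Sum>i\<in>set xs. h i)"
proof -
  have "(\<Sum>j<M. if j < length xs then h (xs ! j) else 0) = (\<Sum>j<length xs. h (xs ! j))"
    using assms(2) by (intro sum.mono_neutral_cong_right) auto
  also have "\<dots> = (\<Sum>i\<in>set xs. h i)"
    by (rule sum.reindex_bij_betw[OF bij_betw_nth[OF assms(1) refl refl]])
  finally show ?thesis .
qed

text \<open>Every branch rejects or continues with the same \<open>T\<close>, so the acceptance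
  probability of \<open>T\<close> factors out.\<close>

lemma accept_trial_le:
  assumes S: "sat n f \<noteq> {}" and L: "L > 0"
  shows "accept_prob n f (trial n L m T) \<le> (1 - trial_gain n f L m) * accept_prob n f T"
proof -
  let ?S = "sat n f" and ?A = "accept_prob n f T"
  have N: "card ?S > 0" using S by (simp add: card_gt_0_iff)
  have pair: "accept_prob n f (if length (diff_coords n x z) > 2 * L then Halt False
     else Draw (pmf_of_set {..<4 * L}) (\<lambda>j.
       if j < length (diff_coords n x z) then edge_check (diff_coords n x z ! j) x z m T else T))
     \<le> (1 - gain n f L m x z) * ?A" for x z
  proof (cases "length (diff_coords n x z) > 2 * L")
    case False
    let ?D = "diff_coords n x z"
    let ?h = "\<lambda>i. if \<not> f (flip i x) \<and> \<not> f (flip i z) then 1 else hit n f i m"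
    have "accept_prob n f (Draw (pmf_of_set {..<4 * L}) (\<lambda>j.
       if j < length ?D then edge_check (?D ! j) x z m T else T))
      = (\<Sum>j<4 * L. accept_prob n f (if j < length ?D then edge_check (?D ! j) x z m T else T))
        / (4 * L)"
      using L by (subst accept_prob_Draw_of_set) (auto simp: lessThan_empty_iff)
    also have "\<dots> \<le> (\<Sum>j<4 * L. (1 - (if j < length ?D then ?h (?D ! j) else 0)) * ?A) / (4 * L)"
    proof (intro divide_right_mono sum_mono)
      show "accept_prob n f (if j < length ?D then edge_check (?D ! j) x z m T else T)
        \<le> (1 - (if j < length ?D then ?h (?D ! j) else 0)) * ?A" for j
        using accept_edge_check_le[OF S, of "?D ! j" x z m T] by (cases "j < length ?D") simp_all
    qed simp
    also have "(\<Sum>j<4 * L. (1 - (if j < length ?D then ?h (?D ! j) else 0)) * ?A)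
      = (4 * L - (\<Sum>i\<in>set ?D. ?h i)) * ?A"
      using sum_nth_if_less[OF distinct_diff_coords, of n x z "4 * L" ?h] False
      unfolding sum_distrib_right[symmetric] sum_subtractf by simp
    also have "(4 * L - (\<Sum>i\<in>set ?D. ?h i)) * ?A / (4 * L) = (1 - gain n f L m x z) * ?A"
      using False L by (simp add: gain_def field_simps)
    finally show ?thesis using False by simp
  qed (simp add: gain_def)
  have "accept_prob n f (trial n L m T) \<le>
    (\<Sum>x\<in>?S. (\<Sum>z\<in>?S. (1 - gain n f L m x z) * ?A) / card ?S) / card ?S"
    unfolding trial_def accept_prob_Call_SAMP[OF S]
    by (intro divide_right_mono sum_mono pair) simp_all
  also have "\<dots> = (\<Sum>x\<in>?S. \<Sum>z\<in>?S. (1 - gain n f L m x z)) * ?A / (card ?S)\<^sup>2"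
    by (simp add: sum_divide_distrib sum_distrib_right power2_eq_square)
  also have "\<dots> = (1 - trial_gain n f L m) * ?A"
  proof -
    have "(\<Sum>x\<in>?S. \<Sum>z\<in>?S. (1 - gain n f L m x z))
      = (card ?S)\<^sup>2 - (\<Sum>x\<in>?S. \<Sum>z\<in>?S. gain n f L m x z)"
      by (simp add: sum_subtractf power2_eq_square)
    moreover have "1 - trial_gain n f L m =
      ((card ?S)\<^sup>2 - (\<Sum>x\<in>?S. \<Sum>z\<in>?S. gain n f L m x z)) / (card ?S)\<^sup>2"
      using S by (simp add: trial_gain_def diff_divide_distrib)
    ultimately show ?thesis by (simp only: times_divide_eq_left)
  qed
  finally show ?thesis .
qed

lemma accept_trials_le:
  assumes S: "sat n f \<noteq> {}" and L: "L > 0"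
  shows "accept_prob n f (trials n L ms) \<le> exp (- (\<Sum>m\<leftarrow>ms. trial_gain n f L m))"
proof (induction ms)
  case Nil
  then show ?case by (simp add: trials_def)
next
  case (Cons m ms)
  have "accept_prob n f (trials n L (m # ms))
      \<le> (1 - trial_gain n f L m) * accept_prob n f (trials n L ms)"
    using accept_trial_le[OF S L] by (simp add: trials_def)
  also have "\<dots> \<le> exp (- trial_gain n f L m) * accept_prob n f (trials n L ms)"
    using exp_ge_add_one_self[of "- trial_gain n f L m"]
    by (intro mult_right_mono) (simp_all add: accept_prob_nonneg)
  also have "\<dots> \<le> exp (- trial_gain n f L m) * exp (- (\<Sum>m\<leftarrow>ms. trial_gain n f L m))"
    using Cons by (intro mult_left_mono) simp_all
  finally show ?case by (simp flip: exp_add)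
qed

section \<open>Soundness of a trial\<close>

locale unateness_instance =
  fixes n :: nat and f :: "bool list \<Rightarrow> bool" and L :: nat
  assumes S_nonempty: "sat n f \<noteq> {}" and L_pos: "L > 0"
begin

abbreviation "S \<equiv> sat n f"

definition maj :: "nat \<Rightarrow> bool" where
  "maj i \<longleftrightarrow> card S \<le> 2 * card {x \<in> S. x ! i}"

definition minor :: "nat \<Rightarrow> bool list set" where
  "minor i = {x \<in> S. x ! i \<noteq> maj i}"

text \<open>\<open>against\<close> collects the bichromatic edges whose satisfying endpoint has the
  minority bit, \<open>along\<close> those where it has the majority bit.\<close>

definition against :: "nat \<Rightarrow> bool list set" where
  "against i = viol maj i S"

definition along :: "nat \<Rightarrow> bool list set" where
  "along i = viol (\<lambda>i. \<not> maj i) i S"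

text \<open>The threshold one third makes \<open>along i\<close> at least a third of
  \<open>S\<close> in biased directions, and lets two samples differ with probability at least 4/9
  in balanced ones.\<close>

definition biased :: "nat set" where
  "biased = {i. i < n \<and> 3 * card (minor i) < card S}"

definition balanced :: "nat set" where
  "balanced = {i. i < n \<and> card S \<le> 3 * card (minor i)}"

text \<open>The radius \<open>4 * L\<close> is twice the distance a trial tolerates, which exposes
  heavy points, and equals the range of the random index, which suits light points.\<close>

definition light :: "bool list set" where
  "light = {x \<in> S. card {i \<in> biased. x ! i \<noteq> maj i} \<le> 4 * L}"

lemma card_S_pos: "card S > 0"
  using S_nonempty by (simp add: card_gt_0_iff)

lemma finite_biased [simp]: "finite biased" and finite_balanced [simp]: "finite balanced"
  by (simp_all add: biased_def balanced_def)

lemma finite_light [simp]: "finite light"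
  by (simp add: light_def)

lemma light_subset: "light \<subseteq> S"
  by (auto simp: light_def)

lemma S_subset_cube: "S \<subseteq> cube n"
  by (auto simp: sat_def)

lemma against_subset: "against i \<subseteq> S" and along_subset: "along i \<subseteq> S"
  by (auto simp: against_def along_def viol_def)

lemma card_split: "card {x \<in> S. P x} + card {x \<in> S. \<not> P x} = card S"
proof -
  have "card ({x \<in> S. P x} \<union> {x \<in> S. \<not> P x}) = card {x \<in> S. P x} + card {x \<in> S. \<not> P x}"
    by (intro card_Un_disjoint) auto
  moreover have "{x \<in> S. P x} \<union> {x \<in> S. \<not> P x} = S" by auto
  ultimately show ?thesis by simp
qed

lemma two_card_minor_le: "2 * card (minor i) \<le> card S"
  using card_split[of "\<lambda>x. x ! i"] unfolding minor_def by (cases "maj i") (auto simp: maj_def)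

text \<open>Flipping bit \<open>i\<close> matches the points of the two halves that lie on no bichromatic edge.\<close>

lemma card_along:
  assumes i: "i < n"
  shows "card (along i) + 2 * card (minor i) = card S + card (against i)"
proof -
  let ?M = "{x \<in> S. x ! i \<noteq> maj i \<and> flip i x \<in> S}" and ?P = "{x \<in> S. x ! i = maj i \<and> flip i x \<in> S}"
  have cube: "x \<in> cube n" if "x \<in> S" for x using that S_subset_cube by blast
  have "?P = flip i ` ?M"
  proof (intro equalityI subsetI)
    fix x assume "x \<in> ?P"
    then have "flip i x \<in> ?M" using i cube[of x] by auto
    then show "x \<in> flip i ` ?M" by (rule image_flipI)
  next
    fix y assume "y \<in> flip i ` ?M"
    then obtain x where "x \<in> ?M" "y = flip i x" by blast
    then show "y \<in> ?P" using i cube[of x] by auto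
  qed
  then have PM: "card ?P = card ?M" by (simp add: card_image inj_on_flip)
  have "card (minor i) = card (against i \<union> ?M)"
    by (rule arg_cong[where f = card]) (auto simp: minor_def against_def viol_def)
  also have "\<dots> = card (against i) + card ?M"
    by (intro card_Un_disjoint) (auto simp: against_def viol_def)
  finally have 1: "card (minor i) = card (against i) + card ?M" .
  have "card {x \<in> S. x ! i = maj i} = card (along i \<union> ?P)"
    by (rule arg_cong[where f = card]) (auto simp: along_def viol_def)
  also have "\<dots> = card (along i) + card ?P"
    by (intro card_Un_disjoint) (auto simp: along_def viol_def)
  finally have 2: "card {x \<in> S. x ! i = maj i} = card (along i) + card ?P" .
  have "card (minor i) + card {x \<in> S. x ! i = maj i} = card S"
    using card_split[of "\<lambda>x. x ! i \<noteq> maj i"] by (simp add: minor_def)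
  then show ?thesis using 1 2 PM by simp
qed

lemma card_along_biased: "i \<in> biased \<Longrightarrow> card S \<le> 3 * card (along i)"
  using card_along[of i] by (simp add: biased_def)

text \<open>By \<open>card_along\<close>, the edges against the majority are the rarer kind.\<close>

lemma edge_freq_min:
  assumes "i < n"
  shows "min (edge_freq n f False i) (edge_freq n f True i) = card (against i) / card S"
proof -
  have eq: "viol a i S = viol (\<lambda>_. a i) i S" for a by (simp add: viol_def)
  have "card (against i) \<le> card (along i)"
    using card_along[OF assms] two_card_minor_le[of i] by linarith
  then have "real (card (against i)) / card S \<le> card (along i) / card S"
    by (simp add: divide_right_mono)
  moreover have "edge_freq n f (maj i) i = card (against i) / card S"
    "edge_freq n f (\<not> maj i) i = card (along i) / card S"
    unfolding edge_freq_def against_def along_def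
    using eq[of maj] eq[of "\<lambda>i. \<not> maj i"] by simp_all
  ultimately show ?thesis by (cases "maj i") auto
qed

text \<open>
  Points far from the majority point are deleted before sorting. Being far is measured on biased
  coordinates only: then the deletion creates no new bichromatic edge in a balanced direction, and
  none against the majority in a biased one.
\<close>

lemma card_viol_light:
  assumes i: "i < n"
  shows "i \<in> biased \<Longrightarrow> viol maj i light = against i \<inter> light"
    and "i \<in> balanced \<Longrightarrow> viol maj i light \<subseteq> against i"
proof -
  have *: "flip i x \<in> light" if x: "x \<in> light" "x ! i \<noteq> maj i" "flip i x \<in> S" for x
  proof -
    have xc: "x \<in> cube n" using x light_subset S_subset_cube by blast
    \<comment> \<open>Moving \<open>x\<close> towards the majority adds no biased minority
      coordinate, so the point stays light.\<close>
    have "{j \<in> biased. flip i x ! j \<noteq> maj j} \<subseteq> {j \<in> biased. x ! j \<noteq> maj j}"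
    proof
      fix j assume "j \<in> {j \<in> biased. flip i x ! j \<noteq> maj j}"
      then show "j \<in> {j \<in> biased. x ! j \<noteq> maj j}"
        using x i xc by (cases "i = j") auto
    qed
    then have "card {j \<in> biased. flip i x ! j \<noteq> maj j} \<le> card {j \<in> biased. x ! j \<noteq> maj j}"
      by (intro card_mono) simp_all
    then show ?thesis using x by (simp add: light_def)
  qed
  have "viol maj i light = against i \<inter> light"
    using * light_subset by (auto simp: viol_def against_def)
  then show "i \<in> biased \<Longrightarrow> viol maj i light = against i \<inter> light"
    "i \<in> balanced \<Longrightarrow> viol maj i light \<subseteq> against i" by auto
qed

lemma card_sum_biased_balanced:
  fixes h :: "nat \<Rightarrow> nat"
  shows "(\<Sum>i<n. h i) = (\<Sum>i\<in>biased. h i) + (\<Sum>i\<in>balanced. h i)"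
proof -
  have "{..<n} = biased \<union> balanced" by (auto simp: biased_def balanced_def)
  moreover have "biased \<inter> balanced = {}" by (auto simp: biased_def balanced_def)
  ultimately show ?thesis by (simp add: sum.union_disjoint)
qed

text \<open>Delete the heavy points, then sort the light ones along \<open>maj\<close>;
  \<open>card_viol_light\<close> bounds the violations that the sorting has to repair.\<close>

lemma reldist_Unate_bound:
  "reldist_Unate n f * card S \<le> card (S - light) +
     2 * (\<Sum>i\<in>biased. card (against i \<inter> light)) + 2 * (\<Sum>i\<in>balanced. card (against i))"
proof -
  have "light \<subseteq> cube n" using light_subset S_subset_cube by blast
  then obtain g where g: "g \<in> Unate n"
    "card (sym_diff light (sat n g)) \<le> 2 * (\<Sum>i<n. card (viol maj i light))"
    using unate_repair by blast
  have "card (sym_diff S (sat n g)) \<le> card (sym_diff S light) + card (sym_diff light (sat n g))"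
    by (rule card_sym_diff_triangle) simp_all
  also have "sym_diff S light = S - light" using light_subset by auto
  also have "card (sym_diff light (sat n g)) \<le> 2 * (\<Sum>i<n. card (viol maj i light))"
    by (rule g(2))
  also have "(\<Sum>i<n. card (viol maj i light)) \<le>
    (\<Sum>i\<in>biased. card (against i \<inter> light)) + (\<Sum>i\<in>balanced. card (against i))"
    unfolding card_sum_biased_balanced
  proof (intro add_mono sum_mono)
    fix i
    show "i \<in> biased \<Longrightarrow> card (viol maj i light) \<le> card (against i \<inter> light)"
      using card_viol_light(1)[of i] by (simp add: biased_def)
    show "i \<in> balanced \<Longrightarrow> card (viol maj i light) \<le> card (against i)"
      using card_viol_light(2)[of i] finite_subset[OF against_subset finite_sat]
      by (intro card_mono) (auto simp: balanced_def)
  qed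
  finally have "card (sym_diff S (sat n g)) \<le> card (S - light) +
     2 * (\<Sum>i\<in>biased. card (against i \<inter> light)) + 2 * (\<Sum>i\<in>balanced. card (against i))"
    by simp
  then have "real (card (sym_diff S (sat n g))) \<le> card (S - light) +
     2 * (\<Sum>i\<in>biased. card (against i \<inter> light)) + 2 * (\<Sum>i\<in>balanced. card (against i))"
    by (rule of_nat_mono)
  moreover have "reldist_Unate n f * card S \<le> card (sym_diff S (sat n g))"
    using reldist_Unate_le[OF g(1), of f] card_S_pos by (simp add: reldist_def field_simps)
  ultimately show ?thesis by linarith
qed

section \<open>Lower bounds on the gain\<close>

lemma sum_card_incidence:
  assumes "finite I" "finite X"
  shows "(\<Sum>z\<in>X. real (card {i \<in> I. P i z})) = (\<Sum>i\<in>I. real (card {z \<in> X. P i z}))"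
proof -
  have "(\<Sum>z\<in>X. card {i \<in> I. P i z}) = (\<Sum>i\<in>I. card {z \<in> X. P i z})"
    using assms by (intro sum_multicount_gen) auto
  then show ?thesis by (simp flip: of_nat_sum)
qed

lemma gain_ge_card:
  assumes "length (diff_coords n x z) \<le> 2 * L" and "I \<subseteq> set (diff_coords n x z)"
    and "\<And>i. i \<in> I \<Longrightarrow> \<not> f (flip i x) \<and> \<not> f (flip i z)"
  shows "card I / (4 * L) \<le> gain n f L m x z"
proof -
  have "real (card I) = (\<Sum>i\<in>I. if \<not> f (flip i x) \<and> \<not> f (flip i z) then 1 else hit n f i m)"
    using assms(3) by simp
  also have "\<dots> \<le> (\<Sum>i\<in>set (diff_coords n x z).
      if \<not> f (flip i x) \<and> \<not> f (flip i z) then 1 else hit n f i m)"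
    using assms(2) by (intro sum_mono2) (simp_all add: hit_nonneg)
  finally show ?thesis using assms(1) by (simp add: gain_def divide_right_mono)
qed

text \<open>For each violated biased direction of \<open>x\<close>, a third of the samples
  \<open>z\<close> lie in \<open>along i\<close>, and such a pair shows both kinds of edges.\<close>

lemma sum_gain_light:
  assumes x: "x \<in> light"
  shows "card S * card {i \<in> biased. x \<in> against i} / (12 * L) \<le> (\<Sum>z\<in>S. gain n f L m x z)"
proof -
  let ?V = "{i \<in> biased. x \<in> against i}"
  have "card ?V \<le> card {i \<in> biased. x ! i \<noteq> maj i}"
    by (intro card_mono) (auto simp: against_def viol_def)
  then have V: "card ?V \<le> 4 * L" using x by (simp add: light_def)
  have pt: "card {i \<in> ?V. z \<in> along i} / (4 * L) \<le> gain n f L m x z" if z: "z \<in> S" for z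
  proof (cases "length (diff_coords n x z) > 2 * L")
    case True
    \<comment> \<open>A distant pair has gain 1, which outweighs all its candidate directions
      because lightness leaves at most \<open>4 * L\<close> of them.\<close>
    have "card {i \<in> ?V. z \<in> along i} \<le> card ?V" by (intro card_mono) auto
    then have "real (card {i \<in> ?V. z \<in> along i}) \<le> real (4 * L)"
      using V of_nat_le_iff le_trans by blast
    then show ?thesis using True L_pos by (simp add: gain_def)
  next
    case False
    then show ?thesis
      using x z light_subset S_subset_cube
      by (intro gain_ge_card)
        (auto simp: set_diff_coords against_def along_def viol_def biased_def sat_def)
  qed
  have "real (card S * card ?V) = (\<Sum>i\<in>?V. real (card S))" by simp
  also have "\<dots> \<le> (\<Sum>i\<in>?V. 3 * real (card (along i)))"
  proof (rule sum_mono)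
    show "real (card S) \<le> 3 * real (card (along i))" if "i \<in> ?V" for i
      using of_nat_mono[OF card_along_biased[of i], where 'a = real] that by simp
  qed
  also have "\<dots> = 3 * (\<Sum>i\<in>?V. real (card {z \<in> S. z \<in> along i}))"
    unfolding sum_distrib_left using along_subset
    by (intro sum.cong refl) (auto intro!: arg_cong[where f = card])
  also have "\<dots> = 3 * (\<Sum>z\<in>S. real (card {i \<in> ?V. z \<in> along i}))"
    by (subst sum_card_incidence) simp_all
  finally have "real (card S * card ?V) / (12 * L) \<le>
      3 * (\<Sum>z\<in>S. real (card {i \<in> ?V. z \<in> along i})) / (12 * L)"
    by (intro divide_right_mono) simp_all
  also have "\<dots> = (\<Sum>z\<in>S. card {i \<in> ?V. z \<in> along i} / (4 * L))"
    by (simp add: sum_divide_distrib[symmetric])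
  also have "\<dots> \<le> (\<Sum>z\<in>S. gain n f L m x z)"
    by (intro sum_mono pt)
  finally show ?thesis by simp
qed

text \<open>On average \<open>z\<close> differs from \<open>x\<close> on two thirds of
  \<open>M\<close>. A tolerated pair differs on at most \<open>2 * L\<close>, less than half of
  \<open>M\<close>, so a pair is too distant with probability at least 2/3 - 1/2.\<close>

lemma sum_gain_heavy:
  assumes x: "x \<in> S - light"
  shows "card S / 6 \<le> (\<Sum>z\<in>S. gain n f L m x z)"
proof -
  define M where "M = {i \<in> biased. x ! i \<noteq> maj i}"
  have M: "4 * L < card M" using x by (auto simp: light_def M_def)
  have [simp]: "finite M" by (simp add: M_def)
  have pt: "real (card {i \<in> M. z ! i = maj i}) \<le> 2 * L + card M * gain n f L m x z" for z
  proof (cases "length (diff_coords n x z) > 2 * L")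
    case True
    have "card {i \<in> M. z ! i = maj i} \<le> card M" by (intro card_mono) simp_all
    then show ?thesis using True by (simp add: gain_def)
  next
    case False
    have "card {i \<in> M. z ! i = maj i} \<le> card (set (diff_coords n x z))"
      by (intro card_mono) (auto simp: M_def set_diff_coords biased_def)
    then have "card {i \<in> M. z ! i = maj i} \<le> 2 * L"
      using False distinct_card[OF distinct_diff_coords, of n x z] by simp
    then have "real (card {i \<in> M. z ! i = maj i}) \<le> 2 * L"
      using of_nat_le_iff by blast
    moreover have "0 \<le> card M * gain n f L m x z" by (simp add: gain_nonneg)
    ultimately show ?thesis by linarith
  qed
  have "2 * real (card S) \<le> 3 * real (card {z \<in> S. z ! i = maj i})" if "i \<in> M" for i
  proof -
    have "2 * card S \<le> 3 * card {z \<in> S. z ! i = maj i}"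
      using that card_split[of "\<lambda>x. x ! i \<noteq> maj i"] by (simp add: M_def biased_def minor_def)
    then show ?thesis using of_nat_mono[of _ _, where 'a = real] by fastforce
  qed
  then have "(\<Sum>i\<in>M. 2 * real (card S)) \<le> (\<Sum>i\<in>M. 3 * real (card {z \<in> S. z ! i = maj i}))"
    by (rule sum_mono)
  then have "2 * card M * card S \<le> 3 * (\<Sum>i\<in>M. real (card {z \<in> S. z ! i = maj i}))"
    by (simp add: sum_distrib_left)
  also have "\<dots> = 3 * (\<Sum>z\<in>S. real (card {i \<in> M. z ! i = maj i}))"
    by (subst sum_card_incidence) simp_all
  also have "\<dots> \<le> 3 * (\<Sum>z\<in>S. 2 * L + card M * gain n f L m x z)"
    by (intro mult_left_mono sum_mono pt) simp
  also have "\<dots> = 3 * (2 * real L * card S + card M * (\<Sum>z\<in>S. gain n f L m x z))"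
    by (simp add: sum.distrib sum_distrib_left)
  also have "\<dots> \<le> 3 * (card M / 2 * card S + card M * (\<Sum>z\<in>S. gain n f L m x z))"
    using M by (intro mult_left_mono add_mono mult_right_mono) auto
  finally have "card M * (card S / 6) \<le> card M * (\<Sum>z\<in>S. gain n f L m x z)"
    by (simp add: field_simps)
  then show ?thesis using M by (simp add: mult_le_cancel_left)
qed

lemma trial_gain_heavy: "card (S - light) / (6 * card S) \<le> trial_gain n f L m"
proof -
  have "card (S - light) * (card S / 6) = (\<Sum>x\<in>S - light. card S / 6)" by simp
  also have "\<dots> \<le> (\<Sum>x\<in>S - light. \<Sum>z\<in>S. gain n f L m x z)"
    by (intro sum_mono sum_gain_heavy)
  also have "\<dots> \<le> (\<Sum>x\<in>S. \<Sum>z\<in>S. gain n f L m x z)"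
    by (intro sum_mono2) (auto simp: gain_nonneg sum_nonneg)
  finally have "card (S - light) * (card S / 6) / (card S)\<^sup>2 \<le> trial_gain n f L m"
    unfolding trial_gain_def by (intro divide_right_mono) simp_all
  then show ?thesis using S_nonempty by (simp add: power2_eq_square)
qed

lemma trial_gain_biased:
  "(\<Sum>i\<in>biased. card (against i \<inter> light)) / (12 * L * card S) \<le> trial_gain n f L m"
proof -
  have "(\<Sum>i\<in>biased. real (card (against i \<inter> light)))
    = (\<Sum>i\<in>biased. real (card {x \<in> light. x \<in> against i}))"
    by (simp add: Int_def conj_commute)
  also have "\<dots> = (\<Sum>x\<in>light. real (card {i \<in> biased. x \<in> against i}))"
    by (subst sum_card_incidence) simp_all
  finally have "card S * (\<Sum>i\<in>biased. real (card (against i \<inter> light))) / (12 * L)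
    = (\<Sum>x\<in>light. card S * card {i \<in> biased. x \<in> against i} / (12 * L))"
    by (simp add: sum_distrib_left sum_divide_distrib)
  also have "\<dots> \<le> (\<Sum>x\<in>light. \<Sum>z\<in>S. gain n f L m x z)"
    by (intro sum_mono sum_gain_light)
  also have "\<dots> \<le> (\<Sum>x\<in>S. \<Sum>z\<in>S. gain n f L m x z)"
    using light_subset by (intro sum_mono2) (auto simp: gain_nonneg sum_nonneg)
  finally have "card S * (\<Sum>i\<in>biased. real (card (against i \<inter> light))) / (12 * L) / (card S)\<^sup>2
      \<le> trial_gain n f L m"
    unfolding trial_gain_def by (intro divide_right_mono) simp_all
  then show ?thesis using S_nonempty by (simp add: power2_eq_square mult_ac)
qed

text \<open>This is \<open>2 * p * (1 - p) \<ge> 4 / 9\<close> for a minority fraction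
  \<open>p\<close> between 1/3 and 1/2.\<close>

lemma balanced_pairs:
  assumes i: "i \<in> balanced"
  shows "4 * (card S)\<^sup>2 \<le> 9 * card {(x, z) \<in> S \<times> S. x ! i \<noteq> z ! i}"
proof -
  let ?Q = "minor i" and ?R = "{x \<in> S. x ! i = maj i}"
  have fin: "finite ?Q" by (simp add: minor_def)
  have "{(x, z) \<in> S \<times> S. x ! i \<noteq> z ! i} = ?Q \<times> ?R \<union> ?R \<times> ?Q"
    by (auto simp: minor_def)
  moreover have "card (?Q \<times> ?R \<union> ?R \<times> ?Q) = card (?Q \<times> ?R) + card (?R \<times> ?Q)"
    using fin by (intro card_Un_disjoint) (auto simp: minor_def)
  ultimately have c: "card {(x, z) \<in> S \<times> S. x ! i \<noteq> z ! i} = card ?Q * card ?R + card ?R * card ?Q"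
    by (simp only: card_cartesian_product)
  have sum: "card S = card ?Q + card ?R"
    using card_split[of "\<lambda>x. x ! i \<noteq> maj i"] by (simp add: minor_def)
  have "card ?R \<le> 2 * card ?Q" "card ?Q \<le> card ?R"
    using i two_card_minor_le[of i] sum by (simp_all add: balanced_def)
  \<comment> \<open>In terms of the nonnegative slacks \<open>e\<close> and \<open>r\<close> the
    inequality holds coefficient by coefficient.\<close>
  obtain e where e: "card ?R = card ?Q + e"
    using le_Suc_ex[OF \<open>card ?Q \<le> card ?R\<close>] by blast
  then have "e \<le> card ?Q" using \<open>card ?R \<le> 2 * card ?Q\<close> by simp
  then obtain r where r: "card ?Q = e + r" using le_Suc_ex by blast
  have "4 * (card ?Q + (card ?Q + e))\<^sup>2 \<le> 9 * (card ?Q * (card ?Q + e) + (card ?Q + e) * card ?Q)"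
    unfolding r by (simp add: power2_eq_square algebra_simps)
  then show ?thesis by (simp only: c sum e)
qed

text \<open>Unless a ninth of all pairs is too distant, each balanced direction separates at least
  4/9 - 1/9 = 1/3 of all pairs within the tolerated distance. Such a pair differs in at most
  \<open>2 * L\<close> coordinates, so double counting leaves at most \<open>6 * L\<close> balanced
  directions.\<close>

lemma trial_gain_balanced:
  obtains "\<And>m. 1 / 9 \<le> trial_gain n f L m"
  | "card balanced \<le> 6 * L" "\<And>m. (\<Sum>i\<in>balanced. hit n f i m) / (12 * L) \<le> trial_gain n f L m"
proof -
  define far where "far = {(x, z) \<in> S \<times> S. length (diff_coords n x z) > 2 * L}"
  define near where "near = {(x, z) \<in> S \<times> S. length (diff_coords n x z) \<le> 2 * L}"
  define cut where "cut i = {p \<in> near. fst p ! i \<noteq> snd p ! i}" for i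
  have fin: "finite far" "finite near" by (auto simp: far_def near_def intro: finite_subset[of _ "S \<times> S"])
  have tg: "trial_gain n f L m = (\<Sum>(x, z)\<in>S \<times> S. gain n f L m x z) / (card S)\<^sup>2" for m
    by (simp add: trial_gain_def sum.cartesian_product)
  have N2: "0 < real ((card S)\<^sup>2)" using S_nonempty by (simp add: card_gt_0_iff)
  show thesis
  proof (cases "(card S)\<^sup>2 \<le> 9 * card far")
    case True
    have "1 / 9 \<le> trial_gain n f L m" for m
    proof -
      have "(\<Sum>(x, z)\<in>far. gain n f L m x z) = (\<Sum>p\<in>far. 1)"
        by (intro sum.cong) (auto simp: far_def gain_def)
      then have "real (card far) = (\<Sum>(x, z)\<in>far. gain n f L m x z)" by simp
      also have "\<dots> \<le> (\<Sum>(x, z)\<in>S \<times> S. gain n f L m x z)"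
        by (intro sum_mono2) (auto simp: far_def gain_nonneg)
      finally have "real (card far) \<le> (\<Sum>(x, z)\<in>S \<times> S. gain n f L m x z)" .
      moreover have "real ((card S)\<^sup>2) \<le> 9 * real (card far)"
        using of_nat_mono[OF True, where 'a = real] by simp
      ultimately show ?thesis unfolding tg using N2 by (simp add: field_simps)
    qed
    then show thesis by (rule that(1))
  next
    case False
    have cut: "(card S)\<^sup>2 \<le> 3 * card (cut i)" if i: "i \<in> balanced" for i
    proof -
      have "card {(x, z) \<in> S \<times> S. x ! i \<noteq> z ! i} \<le> card (far \<union> cut i)"
        using fin by (intro card_mono) (auto simp: far_def near_def cut_def)
      also have "\<dots> \<le> card far + card (cut i)" by (rule card_Un_le)
      finally show ?thesis using False balanced_pairs[OF i] by linarith
    qed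
    have cut': "real ((card S)\<^sup>2) \<le> 3 * real (card (cut i))" if "i \<in> balanced" for i
      using of_nat_mono[OF cut[OF that], where 'a = real] by simp
    have D: "{i \<in> balanced. fst p ! i \<noteq> snd p ! i} \<subseteq> set (diff_coords n (fst p) (snd p))" for p
      by (auto simp: set_diff_coords balanced_def)
    have "real (card balanced) * (card S)\<^sup>2 = (\<Sum>i\<in>balanced. real ((card S)\<^sup>2))" by simp
    also have "\<dots> \<le> (\<Sum>i\<in>balanced. 3 * real (card (cut i)))"
      by (intro sum_mono cut')
    also have "\<dots> = 3 * (\<Sum>p\<in>near. real (card {i \<in> balanced. fst p ! i \<noteq> snd p ! i}))"
      using fin by (subst sum_card_incidence) (simp_all add: cut_def sum_distrib_left)
    also have "\<dots> \<le> 3 * (\<Sum>p\<in>near. 2 * real L)"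
    proof (intro mult_left_mono sum_mono)
      fix p assume "p \<in> near"
      then have "length (diff_coords n (fst p) (snd p)) \<le> 2 * L" by (auto simp: near_def)
      then have "card {i \<in> balanced. fst p ! i \<noteq> snd p ! i} \<le> 2 * L"
        using card_mono[OF _ D[of p]] distinct_card[OF distinct_diff_coords, of n "fst p" "snd p"]
        by simp
      then show "real (card {i \<in> balanced. fst p ! i \<noteq> snd p ! i}) \<le> 2 * real L"
        by linarith
    qed simp
    also have "\<dots> = 6 * L * card near" by simp
    also have "\<dots> \<le> 6 * L * (card S)\<^sup>2"
    proof -
      have "card near \<le> card (S \<times> S)" by (intro card_mono) (auto simp: near_def)
      then show ?thesis by (simp add: card_cartesian_product power2_eq_square flip: of_nat_mult)
    qed
    finally have "real (card balanced) \<le> 6 * L" using N2 by simp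
    then have B: "card balanced \<le> 6 * L" by linarith
    have "(\<Sum>i\<in>balanced. hit n f i m) / (12 * L) \<le> trial_gain n f L m" for m
    proof -
      have "(\<Sum>i\<in>balanced. hit n f i m) * (card S)\<^sup>2 = (\<Sum>i\<in>balanced. hit n f i m * (card S)\<^sup>2)"
        by (simp add: sum_distrib_right)
      also have "\<dots> \<le> (\<Sum>i\<in>balanced. hit n f i m * (3 * card (cut i)))"
        using cut' by (intro sum_mono mult_left_mono hit_nonneg) simp
      also have "\<dots> = 3 * (\<Sum>i\<in>balanced. \<Sum>p\<in>near. of_bool (fst p ! i \<noteq> snd p ! i) * hit n f i m)"
      proof -
        have "real (card (cut i)) = (\<Sum>p\<in>near. of_bool (fst p ! i \<noteq> snd p ! i))" for i
          using fin by (simp add: cut_def of_bool_def sum.If_cases Int_def)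
        then show ?thesis by (simp add: sum_distrib_left sum_distrib_right mult_ac)
      qed
      also have "\<dots> = 3 * (\<Sum>p\<in>near. \<Sum>i\<in>balanced. of_bool (fst p ! i \<noteq> snd p ! i) * hit n f i m)"
        by (subst sum.swap) simp
      also have "\<dots> \<le> 3 * (\<Sum>p\<in>near. 4 * L * gain n f L m (fst p) (snd p))"
      proof (intro mult_left_mono sum_mono)
        fix p assume p: "p \<in> near"
        let ?D = "set (diff_coords n (fst p) (snd p))"
        have "(\<Sum>i\<in>balanced. of_bool (fst p ! i \<noteq> snd p ! i) * hit n f i m)
          = (\<Sum>i\<in>{i \<in> balanced. fst p ! i \<noteq> snd p ! i}. hit n f i m)"
          by (intro sum.mono_neutral_cong_right) auto
        also have "\<dots> \<le> (\<Sum>i\<in>?D. hit n f i m)"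
          by (intro sum_mono2 D) (simp_all add: hit_nonneg)
        also have "\<dots> \<le> (\<Sum>i\<in>?D.
            if \<not> f (flip i (fst p)) \<and> \<not> f (flip i (snd p)) then 1 else hit n f i m)"
          by (intro sum_mono) (simp add: hit_le_1)
        also have "\<dots> = 4 * L * gain n f L m (fst p) (snd p)"
          using p L_pos by (auto simp: gain_def near_def)
        finally show "(\<Sum>i\<in>balanced. of_bool (fst p ! i \<noteq> snd p ! i) * hit n f i m)
          \<le> 4 * L * gain n f L m (fst p) (snd p)" .
      qed simp
      also have "\<dots> = 12 * L * (\<Sum>p\<in>near. gain n f L m (fst p) (snd p))"
        by (simp add: sum_distrib_left mult.assoc)
      also have "\<dots> \<le> 12 * L * (\<Sum>p\<in>S \<times> S. gain n f L m (fst p) (snd p))"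
        by (intro mult_left_mono sum_mono2) (auto simp: near_def gain_nonneg)
      finally show ?thesis
        unfolding tg using N2 L_pos by (simp add: case_prod_beta field_simps)
    qed
    then show thesis using B by (intro that(2))
  qed
qed

end

section \<open>The schedule of trials\<close>

text \<open>The factor 2000 brings the total gain to at least 2, the balanced case being the
  tightest.\<close>

definition reps :: "real \<Rightarrow> nat \<Rightarrow> nat" where
  "reps s k = nat \<lceil>2000 * s / 2 ^ k\<rceil>"

text \<open>The finest level resolves frequencies down to \<open>1 / (48 * s)\<close>, so that
  \<open>6 * L\<close> balanced directions below it lose at most \<open>\<epsilon> / 8\<close> when
  \<open>s = L / \<epsilon>\<close>.\<close>

definition levels :: "real \<Rightarrow> nat" where
  "levels s = nat \<lceil>log 2 (48 * s)\<rceil>"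

definition schedule :: "real \<Rightarrow> nat list" where
  "schedule s = concat (map (\<lambda>k. replicate (reps s k) (2 ^ k)) [0..<Suc (levels s)])"

lemma sum_list_schedule:
  fixes g :: "nat \<Rightarrow> real"
  shows "(\<Sum>m\<leftarrow>schedule s. g m) = (\<Sum>k\<le>levels s. reps s k * g (2 ^ k))"
proof -
  have *: "sum_list (map g (concat (map (\<lambda>k. replicate (r k) (2 ^ k)) ks)))
    = sum_list (map (\<lambda>k. r k * g (2 ^ k)) ks)" for r :: "nat \<Rightarrow> nat" and ks
    by (induction ks) (simp_all add: sum_list_replicate)
  have "(\<Sum>m\<leftarrow>schedule s. g m) = (\<Sum>k\<leftarrow>[0..<Suc (levels s)]. reps s k * g (2 ^ k))"
    unfolding schedule_def by (rule *)
  also have "\<dots> = (\<Sum>k\<in>{0..<Suc (levels s)}. reps s k * g (2 ^ k))"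
    by (subst sum_list_distinct_conv_sum_set) (simp_all only: distinct_upt set_upt)
  also have "{0..<Suc (levels s)} = {..levels s}" by auto
  finally show ?thesis .
qed

lemma reps_ge: "2000 * s / 2 ^ k \<le> reps s k"
  unfolding reps_def by linarith

lemma two_power_levels_ge:
  assumes "s \<ge> 1"
  shows "48 * s \<le> 2 ^ levels s"
proof -
  have "48 * s = 2 powr (log 2 (48 * s))" using assms by simp
  also have "\<dots> \<le> 2 powr (real (levels s))"
    unfolding levels_def by (intro powr_mono) linarith+
  finally show ?thesis by (simp add: powr_realpow)
qed

lemma real_sum_list_cost: "real (\<Sum>m\<leftarrow>ms. 2 * m + 4) = (\<Sum>m\<leftarrow>ms. 2 * real m + 4)"
  by (induction ms) simp_all

text \<open>Since \<open>reps\<close> shrinks like \<open>1 / 2 ^ k\<close>, every level costs about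
  \<open>12000 * s\<close>. Only the number of levels brings in a logarithm, and the rounding in
  \<open>reps\<close> adds a geometric sum.\<close>

lemma schedule_cost:
  assumes s: "1 \<le> s" "s \<le> t"
  shows "(\<Sum>m\<leftarrow>schedule s. 2 * real m + 4) \<le> soft_bound 110000 1 t"
proof -
  let ?K = "levels s"
  have l0: "0 \<le> log 2 (48 * s)" using s by simp
  have K: "real ?K \<le> log 2 (48 * s) + 1" unfolding levels_def using l0 by linarith
  have "(2::real) ^ ?K = 2 powr real ?K" by (simp add: powr_realpow)
  also have "\<dots> \<le> 2 powr (log 2 (48 * s) + 1)" using K by (intro powr_mono) auto
  also have "\<dots> = 96 * s" using s by (simp add: powr_add)
  finally have K2: "(2::real) ^ ?K \<le> 96 * s" .
  have lg: "1 \<le> log 2 (t + 2)" using s by (simp add: le_log_iff)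
  have "log 2 (48 * s) \<le> log 2 (2 ^ 6 * (t + 2))" using s by simp
  also have "\<dots> = log 2 (2 ^ 6) + log 2 (t + 2)" using s by (subst log_mult) simp_all
  also have "\<dots> = 6 + log 2 (t + 2)" by (subst log_nat_power) simp_all
  finally have K3: "real ?K + 1 \<le> 9 * log 2 (t + 2)" using K lg by linarith
  have "(\<Sum>m\<leftarrow>schedule s. 2 * real m + 4) = (\<Sum>k\<le>?K. real (reps s k) * (2 * 2 ^ k + 4))"
    by (simp add: sum_list_schedule)
  also have "\<dots> \<le> (\<Sum>k\<le>?K. 12000 * s + 6 * 2 ^ k)"
  proof (rule sum_mono)
    fix k
    have r: "real (reps s k) \<le> 2000 * s / 2 ^ k + 1"
    proof -
      have "0 \<le> 2000 * s / 2 ^ k" using s by simp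
      then show ?thesis unfolding reps_def by linarith
    qed
    have "real (reps s k) * (2 * 2 ^ k + 4) \<le> real (reps s k) * (6 * 2 ^ k)"
      by (intro mult_left_mono) simp_all
    also have "\<dots> \<le> (2000 * s / 2 ^ k + 1) * (6 * 2 ^ k)"
      by (intro mult_right_mono r) simp
    also have "\<dots> = 12000 * s + 6 * 2 ^ k" by (simp add: field_simps)
    finally show "real (reps s k) * (2 * 2 ^ k + 4) \<le> 12000 * s + 6 * 2 ^ k" .
  qed
  also have "\<dots> = (real ?K + 1) * (12000 * s) + 6 * (\<Sum>k\<le>?K. 2 ^ k)"
    by (simp add: sum.distrib sum_distrib_left)
  also have "(\<Sum>k\<le>?K. (2::real) ^ k) \<le> 2 * 2 ^ ?K"
    using sum_gp[of "2::real" 0 ?K] by (simp add: atMost_atLeast0)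
  also have "(real ?K + 1) * (12000 * s) + 6 * (2 * 2 ^ ?K)
    \<le> (9 * log 2 (t + 2)) * (12000 * t) + 6 * (2 * (96 * t))"
    using K2 s by (intro add_mono mult_mono K3) auto
  also have "\<dots> \<le> (9 * log 2 (t + 2)) * (12000 * t) + 6 * (2 * (96 * (t * log 2 (t + 2))))"
    using mult_left_mono[OF lg, of t] s by simp
  \<comment> \<open>The constants add up to 9 * 12000 + 12 * 96 = 109152.\<close>
  also have "\<dots> \<le> 110000 * (t * log 2 (t + 2))"
    using s lg by simp
  finally show ?thesis by (simp add: soft_bound_def mult_ac)
qed

text \<open>
  The level \<open>k\<close> with \<open>2 ^ k\<close> about \<open>1 / w\<close> alone contributes enough: by then both kinds of edges
  have been seen with constant probability.
\<close>

lemma sum_hit_ge: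
  defines "w n f i \<equiv> min (edge_freq n f False i) (edge_freq n f True i)"
  shows "(w n f i - 1 / 2 ^ K) / 10 \<le> (\<Sum>k\<le>K. hit n f i (2 ^ k) / 2 ^ k)"
proof (cases "w n f i \<le> 1 / 2 ^ K")
  \<comment> \<open>Frequencies below the finest level make the left side nonpositive.\<close>
  case True
  have "0 \<le> (\<Sum>k\<le>K. hit n f i (2 ^ k) / 2 ^ k)" by (intro sum_nonneg) (simp add: hit_nonneg)
  moreover have "(w n f i - 1 / 2 ^ K) / 10 \<le> 0" using True by simp
  ultimately show ?thesis by (rule order_trans[rotated])
next
  case False
  \<comment> \<open>Minimality gives \<open>1 / 2 ^ k \<le> w n f i \<le> 2 / 2 ^ k\<close>.\<close>
  define k where "k = (LEAST k. 1 / 2 ^ k \<le> w n f i)"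
  have k: "1 / 2 ^ k \<le> w n f i"
    unfolding k_def by (rule LeastI[of _ K]) (use False in simp)
  have kK: "k \<le> K"
    unfolding k_def by (rule Least_le) (use False in simp)
  have w1: "w n f i \<le> 1" using edge_freq_le_1[of n f False i] by (simp add: w_def min_le_iff_disj)
  have w2: "w n f i \<le> 2 / 2 ^ k"
  proof (cases k)
    case 0
    then show ?thesis using w1 by simp
  next
    case (Suc j)
    then have "\<not> 1 / 2 ^ j \<le> w n f i" using not_less_Least[of j] unfolding k_def by (metis lessI)
    then show ?thesis using Suc by simp
  qed
  have "(1 - w n f i) ^ (2 ^ k) \<le> exp (- w n f i) ^ (2 ^ k)"
    using w1 exp_ge_add_one_self[of "- w n f i"] by (intro power_mono) simp_all
  also have "\<dots> = exp (- (2 ^ k * w n f i))"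
    by (simp flip: exp_of_nat_mult)
  also have "\<dots> \<le> exp (- 1)"
    using k by (simp add: field_simps)
  \<comment> \<open>From \<open>exp 1 \<ge> 1 + 1 + 1 / 2\<close>; hence \<open>hit\<close> is at
    least 1 - 4/5.\<close>
  also have "\<dots> \<le> 2 / 5"
    using exp_lower_Taylor_quadratic[of "1 :: real"] by (simp add: exp_minus field_simps)
  finally have "1 / 5 \<le> hit n f i (2 ^ k)" unfolding hit_def w_def by linarith
  then have "1 / 5 / 2 ^ k \<le> hit n f i (2 ^ k) / 2 ^ k" by (intro divide_right_mono) simp_all
  also have "\<dots> \<le> (\<Sum>k\<le>K. hit n f i (2 ^ k) / 2 ^ k)"
    using kK by (intro member_le_sum) (simp_all add: hit_nonneg)
  finally have "1 / 5 / 2 ^ k \<le> (\<Sum>k\<le>K. hit n f i (2 ^ k) / 2 ^ k)" .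
  moreover have "(w n f i - 1 / 2 ^ K) / 10 \<le> (2 / 2 ^ k) / 10"
  proof (rule divide_right_mono)
    have "0 \<le> 1 / (2 :: real) ^ K" by simp
    then show "w n f i - 1 / 2 ^ K \<le> 2 / 2 ^ k" using w2 by linarith
  qed simp
  ultimately show ?thesis by simp
qed

section \<open>Total gain of the schedule\<close>

context unateness_instance
begin

lemma trial_gain_nonneg: "0 \<le> trial_gain n f L m"
  unfolding trial_gain_def by (intro divide_nonneg_nonneg sum_nonneg gain_nonneg) simp

text \<open>Level 0 alone suffices where the gain bound does not depend on \<open>m\<close>.\<close>

lemma schedule_gain_ge:
  assumes "s \<ge> 0"
  shows "2000 * s * trial_gain n f L 1 \<le> (\<Sum>m\<leftarrow>schedule s. trial_gain n f L m)"
proof -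
  have "2000 * s * trial_gain n f L 1 \<le> reps s 0 * trial_gain n f L (2 ^ 0)"
    using reps_ge[of s 0] by (simp add: mult_right_mono trial_gain_nonneg)
  also have "\<dots> \<le> (\<Sum>k\<le>levels s. reps s k * trial_gain n f L (2 ^ k))"
    by (rule member_le_sum) (simp_all add: trial_gain_nonneg)
  finally show ?thesis by (simp add: sum_list_schedule)
qed

lemma schedule_gain_ge_2:
  assumes far: "\<epsilon> < reldist_Unate n f" and eps: "0 < \<epsilon>" "\<epsilon> < 1"
  shows "2 \<le> (\<Sum>m\<leftarrow>schedule (L / \<epsilon>). trial_gain n f L m)"
proof -
  define N where "N = real (card S)"
  define s where "s = L / \<epsilon>"
  have N: "N > 0" using card_S_pos by (simp add: N_def)
  have s: "s \<ge> 1" using L_pos eps by (simp add: s_def field_simps)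
  have sL: "L = s * \<epsilon>" using eps by (simp add: s_def)
  have "\<epsilon> * N < reldist_Unate n f * N" using far N by simp
  then have total: "\<epsilon> * N < card (S - light) +
     2 * (\<Sum>i\<in>biased. real (card (against i \<inter> light))) + 2 * (\<Sum>i\<in>balanced. real (card (against i)))"
    using reldist_Unate_bound by (simp add: N_def)
  have level0: ?thesis if "c \<le> trial_gain n f L 1" "2 \<le> 2000 * s * c" for c
  proof -
    have "2000 * s * c \<le> 2000 * s * trial_gain n f L 1"
      using that(1) s by (intro mult_left_mono) simp_all
    then show ?thesis using schedule_gain_ge[of s] that(2) s by (simp add: s_def)
  qed
  \<comment> \<open>With the factors in \<open>total\<close> the thresholds sum to 1/4 + 2/8 + 2/4 =
    1.\<close>
  consider (heavy) "\<epsilon> * N / 4 \<le> card (S - light)"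
    | (biased) "\<epsilon> * N / 8 \<le> (\<Sum>i\<in>biased. real (card (against i \<inter> light)))"
    | (balanced) "\<epsilon> * N / 4 \<le> (\<Sum>i\<in>balanced. real (card (against i)))"
    using total by linarith
  then show ?thesis
  proof cases
    case heavy
    have "\<epsilon> / 24 = (\<epsilon> * N / 4) / (6 * N)" using N by simp
    also have "\<dots> \<le> card (S - light) / (6 * N)" using heavy N by (intro divide_right_mono) simp_all
    also have "\<dots> \<le> trial_gain n f L 1" using trial_gain_heavy by (simp add: N_def)
    finally show ?thesis
    proof (rule level0)
      have "1 \<le> \<epsilon> * s" using sL L_pos by (simp add: mult.commute)
      then show "2 \<le> 2000 * s * (\<epsilon> / 24)" by simp
    qed
  next
    case biased
    have "\<epsilon> / (96 * L) = (\<epsilon> * N / 8) / (12 * L * N)" using N by simp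
    also have "\<dots> \<le> (\<Sum>i\<in>biased. real (card (against i \<inter> light))) / (12 * L * N)"
      using biased N by (intro divide_right_mono) simp_all
    also have "\<dots> \<le> trial_gain n f L 1" using trial_gain_biased by (simp add: N_def)
    finally show ?thesis
    proof (rule level0)
      show "2 \<le> 2000 * s * (\<epsilon> / (96 * L))" using L_pos eps by (simp add: s_def)
    qed
  next
    case balanced
    show ?thesis
    proof (rule trial_gain_balanced)
      assume "\<And>m. 1 / 9 \<le> trial_gain n f L m"
      then show ?thesis by (rule level0) (use s in simp)
    next
      assume B: "card balanced \<le> 6 * L"
        and g: "\<And>m. (\<Sum>i\<in>balanced. hit n f i m) / (12 * L) \<le> trial_gain n f L m"
      define K where "K = levels s"
      have P: "48 * L \<le> \<epsilon> * 2 ^ K"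
        using mult_left_mono[OF two_power_levels_ge[OF s], of \<epsilon>] eps sL by (simp add: K_def mult_ac)
      have "real (card balanced) / 2 ^ K \<le> real (6 * L) / 2 ^ K"
        using B by (intro divide_right_mono of_nat_mono) simp_all
      also have "\<dots> \<le> \<epsilon> / 8" using P by (simp add: field_simps)
      finally have B': "real (card balanced) / 2 ^ K \<le> \<epsilon> / 8" .
      have "\<epsilon> / 4 \<le> (\<Sum>i\<in>balanced. real (card (against i))) / N"
        using balanced N by (simp add: field_simps)
      also have "\<dots> = (\<Sum>i\<in>balanced. card (against i) / N)" by (simp add: sum_divide_distrib)
      \<comment> \<open>Subtracting the finest resolution in all balanced directions costs at most
        half of \<open>\<epsilon> / 4\<close>.\<close>
      finally have "\<epsilon> / 8 \<le> (\<Sum>i\<in>balanced. card (against i) / N - 1 / 2 ^ K)"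
        using B' by (simp add: sum_subtractf)
      then have "\<epsilon> / 80 \<le> (\<Sum>i\<in>balanced. (card (against i) / N - 1 / 2 ^ K) / 10)"
        by (simp flip: sum_divide_distrib)
      also have "\<dots> \<le> (\<Sum>i\<in>balanced. \<Sum>k\<le>K. hit n f i (2 ^ k) / 2 ^ k)"
      proof (rule sum_mono)
        fix i assume "i \<in> balanced"
        then have "i < n" by (simp add: balanced_def)
        from sum_hit_ge[of n f i K, unfolded edge_freq_min[OF this]]
        show "(card (against i) / N - 1 / 2 ^ K) / 10 \<le> (\<Sum>k\<le>K. hit n f i (2 ^ k) / 2 ^ k)"
          by (simp add: N_def)
      qed
      also have "\<dots> = (\<Sum>k\<le>K. \<Sum>i\<in>balanced. hit n f i (2 ^ k) / 2 ^ k)" by (rule sum.swap)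
      finally have h: "\<epsilon> / 80 \<le> (\<Sum>k\<le>K. \<Sum>i\<in>balanced. hit n f i (2 ^ k) / 2 ^ k)" .
      \<comment> \<open>As \<open>s = L / \<epsilon>\<close>, the right side is 2000/960.\<close>
      have "2 \<le> 2000 * s / (12 * L) * (\<epsilon> / 80)" using L_pos eps by (simp add: s_def)
      also have "\<dots> \<le> 2000 * s / (12 * L) * (\<Sum>k\<le>K. \<Sum>i\<in>balanced. hit n f i (2 ^ k) / 2 ^ k)"
        using s by (intro mult_left_mono h) simp
      also have "\<dots> = (\<Sum>k\<le>K. 2000 * s / 2 ^ k * ((\<Sum>i\<in>balanced. hit n f i (2 ^ k)) / (12 * L)))"
        by (simp add: sum_distrib_left sum_divide_distrib mult_ac)
      also have "\<dots> \<le> (\<Sum>k\<le>K. reps s k * trial_gain n f L (2 ^ k))"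
        by (intro sum_mono mult_mono reps_ge g)
          (auto intro!: divide_nonneg_nonneg sum_nonneg simp: hit_nonneg)
      also have "\<dots> = (\<Sum>m\<leftarrow>schedule s. trial_gain n f L m)"
        by (simp add: sum_list_schedule K_def)
      finally show ?thesis by (simp add: s_def)
    qed
  qed
qed

lemma reject_far:
  assumes "\<epsilon> < reldist_Unate n f" "0 < \<epsilon>" "\<epsilon> < 1"
  shows "2 / 3 \<le> reject_prob n f (trials n L (schedule (L / \<epsilon>)))"
proof -
  have "accept_prob n f (trials n L (schedule (L / \<epsilon>)))
    \<le> exp (- (\<Sum>m\<leftarrow>schedule (L / \<epsilon>). trial_gain n f L m))"
    by (rule accept_trials_le[OF S_nonempty L_pos])
  also have "\<dots> \<le> exp (- 2)" using schedule_gain_ge_2[OF assms] by simp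
  also have "\<dots> \<le> 1 / 3"
    using exp_ge_add_one_self[of "2 :: real"] by (simp add: exp_minus field_simps)
  finally show ?thesis by (simp add: reject_prob_eq)
qed

end

text \<open>Every coordinate is oriented towards the only satisfying point.\<close>

lemma singleton_sat_unate:
  assumes "card (sat n f) = 1"
  shows "f \<in> Unate n"
proof -
  obtain y where y: "sat n f = {y}" using assms by (auto simp: card_1_singleton_iff)
  have f: "f x \<longleftrightarrow> x = y" if "x \<in> cube n" for x
    using y that by (auto simp: sat_def)
  have upd: "x[i := b] \<in> cube n" if "x \<in> cube n" for x i b
    using that by (simp add: cube_def)
  show ?thesis
    unfolding Unate_def mem_Collect_eq
  proof (intro allI impI)
    fix i assume i: "i < n"
    have "f (x[i := \<not> y ! i]) \<le> f (x[i := y ! i])" if x: "x \<in> cube n" for x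
    proof -
      have "x[i := \<not> y ! i] ! i \<noteq> y ! i" using x i by (simp add: cube_def)
      then have "x[i := \<not> y ! i] \<noteq> y" by metis
      then show ?thesis using f upd[OF x] by simp
    qed
    then show "(\<forall>x\<in>cube n. f (x[i := False]) \<le> f (x[i := True])) \<or>
         (\<forall>x\<in>cube n. f (x[i := False]) \<ge> f (x[i := True]))"
      by (cases "y ! i") auto
  qed
qed

text \<open>
  If \<open>N = 1\<close> the function is unate, and as \<open>log 2 N = 0\<close> no oracle call may be made.
\<close>

definition unate_tester :: "nat \<Rightarrow> nat \<Rightarrow> real \<Rightarrow> tester" where
  "unate_tester n N \<epsilon> = (if N \<le> 1 then Halt True
     else trials n (nat \<lfloor>log 2 N\<rfloor>) (schedule (nat \<lfloor>log 2 N\<rfloor> / \<epsilon>)))"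

theorem theorem5p1:
  "\<exists>(A :: nat \<Rightarrow> nat \<Rightarrow> real \<Rightarrow> tester) (C :: real) (d :: nat).
     \<forall>(n :: nat) (f :: bool list \<Rightarrow> bool) (\<epsilon> :: real) (N :: nat).
       sat n f \<noteq> {} \<and> N = card (sat n f) \<and> 0 < \<epsilon> \<and> \<epsilon> < 1 \<longrightarrow>
         valid_queries n (A n N \<epsilon>) \<and>
         (\<forall>(b, c) \<in> set_pmf (run n f (A n N \<epsilon>)). real c \<le> soft_bound C d (log 2 (real N) / \<epsilon>)) \<and>
         (f \<in> Unate n \<longrightarrow> accept_prob n f (A n N \<epsilon>) = 1) \<and>
         (reldist_Unate n f > \<epsilon> \<longrightarrow> reject_prob n f (A n N \<epsilon>) \<ge> 2 / 3)"
proof (rule exI[of _ unate_tester], rule exI[of _ 110000], rule exI[of _ 1], intro allI impI,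
    elim conjE)
  fix n f N and \<epsilon> :: real
  assume S: "sat n f \<noteq> {}" and N: "N = card (sat n f)" and eps: "0 < \<epsilon>" "\<epsilon> < 1"
  let ?A = "unate_tester n N \<epsilon>"
  show "valid_queries n ?A \<and>
     (\<forall>(b, c) \<in> set_pmf (run n f ?A). real c \<le> soft_bound 110000 1 (log 2 (real N) / \<epsilon>)) \<and>
     (f \<in> Unate n \<longrightarrow> accept_prob n f ?A = 1) \<and>
     (reldist_Unate n f > \<epsilon> \<longrightarrow> reject_prob n f ?A \<ge> 2 / 3)"
  proof (cases "N \<le> 1")
    case True
    then have "N = 1" using S N by (simp add: le_Suc_eq)
    moreover have "f \<in> Unate n" using singleton_sat_unate N \<open>N = 1\<close> by simp
    then have "reldist_Unate n f \<le> 0"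
      using reldist_Unate_le[of f n f] by (simp add: reldist_def)
    ultimately show ?thesis using eps by (simp add: unate_tester_def soft_bound_def)
  next
    case False
    define L where "L = nat \<lfloor>log 2 N\<rfloor>"
    have A: "?A = trials n L (schedule (L / \<epsilon>))" using False by (simp add: unate_tester_def L_def)
    \<comment> \<open>\<open>N \<ge> 2\<close> keeps \<open>L\<close> positive after rounding down,
      and \<open>N < 2 ^ Suc L\<close> is what completeness asks of \<open>L\<close>.\<close>
    have "1 \<le> log 2 N" using False by (simp add: le_log_iff)
    then have L: "L > 0" "real L \<le> log 2 N" "log 2 N < real L + 1"
      unfolding L_def by linarith+
    interpret unateness_instance n f L using S L(1) by unfold_locales
    have "real N = 2 powr log 2 N" using False by simp
    also have "\<dots> < 2 powr real (Suc L)" using L(3) by (intro powr_less_mono) simp_all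
    also have "\<dots> = real (2 ^ Suc L)" by (subst powr_realpow) simp_all
    finally have NL: "card (sat n f) < 2 ^ Suc L" using N by (simp only: of_nat_less_iff)
    have "real c \<le> soft_bound 110000 1 (log 2 (real N) / \<epsilon>)" if "(b, c) \<in> set_pmf (run n f ?A)" for b c
    proof -
      have "c \<le> (\<Sum>m\<leftarrow>schedule (L / \<epsilon>). 2 * m + 4)"
        using calls_trials[OF S, of L "schedule (L / \<epsilon>)"] that by (auto simp: calls_le_def A)
      then have "real c \<le> real (\<Sum>m\<leftarrow>schedule (L / \<epsilon>). 2 * m + 4)" by (rule of_nat_mono)
      also have "\<dots> = (\<Sum>m\<leftarrow>schedule (L / \<epsilon>). 2 * real m + 4)"
        by (rule real_sum_list_cost)
      also have "\<dots> \<le> soft_bound 110000 1 (log 2 (real N) / \<epsilon>)"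
        using L eps by (intro schedule_cost) (simp_all add: field_simps)
      finally show ?thesis .
    qed
    then show ?thesis
      using valid_trials accept_trials_unate[OF S _ NL L(1)] reject_far eps by (auto simp: A)
  qed
qed

end
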